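(* Let $k=k(n)\in\{1,\dots,n\}$. Suppose $k=o((n/\log n)^{1/2})$ and also $k\to\infty$ as $n\to\infty$. Then the random-to-random transposition shuffle has $k$-partial cutoff at time $0.5\,n\log k$ with a window of size $O(n)$. Furthermore, if instead there is a constant $K$ such that $k<K$ for all $n$, then there is no cutoff, i.e. the random-to-random transposition shuffle does not have $k$-partial cutoff (at any time with any window).
   Context: Notation: $[n]=\{1,\dots,n\}$. A permutation $\sigma\in S_n$ is an arrangement of $n$ labelled cards in locations $1,\dots,n$ of a deck; $\sigma^{-1}(i)$ is the location of the card with label $i$. Random-to-random transposition shuffle: at each step $t=1,2,\dots$ the left hand chooses a location $L_t$ and the right hand chooses a location $R_t$, each uniform on $[n]$, independently of each other and of all past choices, and the cards in locations $L_t$ and $R_t$ are swapped (nothing changes if $L_t=R_t$). $\sigma_t$ denotes the permutation at time $t$ started at time $0$ from $\sigma_0$, and $\pi$ a uniform random permutation. For distinct cards $c_1,\dots,c_k\in[n]$, $\mu^{\sigma}_{c_1,\dots,c_k}$ denotes the joint law of the locations $(\sigma^{-1}(c_1),\dots,\sigma^{-1}(c_k))$ in a random permutation $\sigma$. Define $$d_{c_1,\dots,c_k}(t)=\max_{\sigma_0\in S_n}\|\mu^{\sigma_t}_{c_1,\dots,c_k}-\mu^{\pi}_{c_1,\dots,c_k}\|_{\mathrm{TV}},$$ where $\|\cdot\|_{\mathrm{TV}}$ is total variation distance; at a non-integer time $t\geq 0$ this is read at time $\lfloor t\rfloor$. Let $\Omega_k$ be the set of all subsets of $[n]$ of size $k$.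 $k$-partial cutoff: a shuffle (given for each $n$) has $k$-partial cutoff at time $t_{\mathrm{mix}}=t_{\mathrm{mix}}(n)$ with a window of size $\omega(n)=o(t_{\mathrm{mix}})$ (with $\omega(n)>0$) if (i) $\lim_{\alpha\to\infty}\limsup_{n\to\infty}\max_{\{c_1,\dots,c_k\}\in\Omega_k}d_{c_1,\dots,c_k}(t_{\mathrm{mix}}+\alpha\,\omega(n))=0$, and (ii) $\lim_{\alpha\to-\infty}\liminf_{n\to\infty}\max_{\{c_1,\dots,c_k\}\in\Omega_k}d_{c_1,\dots,c_k}(t_{\mathrm{mix}}+\alpha\,\omega(n))=1$. "With a window of size $O(n)$" means that this holds for some window $\omega(n)$ with $\omega(n)=O(n)$. *)

theory Defs
  imports "HOL-Probability.Probability" "HOL-Combinatorics.Combinatorics"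
begin

text \<open>
  A deck of \<open>n\<close> cards is a function \<open>\<sigma>\<close> with \<open>\<sigma> permutes {1..n}\<close>: \<open>\<sigma> i\<close> is the label of the card
  in location \<open>i\<close>, so \<open>inv \<sigma> c\<close> is the location of the card with label \<open>c\<close>.
\<close>

text \<open>\<open>S n \<sigma>\<^sub>0 t\<close> is the law of the deck of \<open>n\<close> cards at time \<open>t\<close> when started from \<open>\<sigma>\<^sub>0\<close>.\<close>

type_synonym shuffle = "nat \<Rightarrow> (nat \<Rightarrow> nat) \<Rightarrow> nat \<Rightarrow> (nat \<Rightarrow> nat) pmf"

text \<open>
  Precomposing with \<open>transpose L R\<close> exchanges the cards in the locations \<open>L\<close> and \<open>R\<close>.
\<close>

definition rtr_step :: "nat \<Rightarrow> (nat \<Rightarrow> nat) \<Rightarrow> (nat \<Rightarrow> nat) pmf" where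
  "rtr_step n \<sigma> =
     map_pmf (\<lambda>(L, R). \<sigma> \<circ> Transposition.transpose L R)
       (pair_pmf (pmf_of_set {1..n}) (pmf_of_set {1..n}))"

primrec rtr_shuffle :: shuffle where
  "rtr_shuffle n \<sigma>\<^sub>0 0 = return_pmf \<sigma>\<^sub>0"
| "rtr_shuffle n \<sigma>\<^sub>0 (Suc t) = bind_pmf (rtr_shuffle n \<sigma>\<^sub>0 t) (rtr_step n)"

definition uniform_perm :: "nat \<Rightarrow> (nat \<Rightarrow> nat) pmf" where
  "uniform_perm n = pmf_of_set {\<sigma>. \<sigma> permutes {1..n}}"

definition tv_dist :: "'a pmf \<Rightarrow> 'a pmf \<Rightarrow> real" where
  "tv_dist p q = (SUP A. \<bar>measure_pmf.prob p A - measure_pmf.prob q A\<bar>)"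

definition location_law :: "nat list \<Rightarrow> (nat \<Rightarrow> nat) pmf \<Rightarrow> nat list pmf" where
  "location_law cs p = map_pmf (\<lambda>\<sigma>. map (inv \<sigma>) cs) p"

text \<open>Negative real times are read as time \<open>0\<close>.\<close>

definition partial_dist :: "shuffle \<Rightarrow> nat \<Rightarrow> nat list \<Rightarrow> real \<Rightarrow> real" where
  "partial_dist S n cs t =
     (MAX \<sigma>\<^sub>0\<in>{\<sigma>. \<sigma> permutes {1..n}}.
        tv_dist (location_law cs (S n \<sigma>\<^sub>0 (nat \<lfloor>t\<rfloor>))) (location_law cs (uniform_perm n)))"

definition card_sets :: "nat \<Rightarrow> nat \<Rightarrow> nat set set" where
  "card_sets n k = {C. C \<subseteq> {1..n} \<and> card C = k}"

text \<open>
  The distance of a list of distinct cards depends only on its set of entries. The maximum below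
  is over all enumerations of all sets in \<open>card_sets n k\<close>, so no enumeration has to be chosen.
\<close>

definition max_partial_dist :: "shuffle \<Rightarrow> nat \<Rightarrow> nat \<Rightarrow> real \<Rightarrow> real" where
  "max_partial_dist S n k t =
     (MAX cs\<in>{cs. distinct cs \<and> set cs \<in> card_sets n k}. partial_dist S n cs t)"

definition partial_cutoff ::
    "shuffle \<Rightarrow> (nat \<Rightarrow> nat) \<Rightarrow> (nat \<Rightarrow> real) \<Rightarrow> (nat \<Rightarrow> real) \<Rightarrow> bool" where
  "partial_cutoff S k t_mix \<omega> \<longleftrightarrow>
     (\<forall>n\<ge>1. \<omega> n > 0) \<and> \<omega> \<in> o(t_mix) \<and>
     ((\<lambda>\<alpha>. limsup (\<lambda>n. ereal (max_partial_dist S n (k n) (t_mix n + \<alpha> * \<omega> n)))) \<longlongrightarrow> 0) at_top \<and>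
     ((\<lambda>\<alpha>. liminf (\<lambda>n. ereal (max_partial_dist S n (k n) (t_mix n + \<alpha> * \<omega> n)))) \<longlongrightarrow> 1) at_bot"

end

theory Submission
  imports Defs "HOL-Real_Asymp.Real_Asymp"
begin

text \<open>
  A step that moves exactly one of the \<open>k\<close> cards sends it to an almost uniform location, and each card
  is moved with probability about \<open>2 / n\<close>; two of them move together with probability \<open>O(k\<^sup>2 / n\<^sup>2)\<close>.
  So up to time \<open>t\<close> the locations follow, up to an error \<open>O(t k\<^sup>2 / n\<^sup>2)\<close>, the chain that resamples
  each coordinate at rate \<open>2 / n\<close>, which vanishes for \<open>t = O(n log k)\<close>
  because \<open>k\<^sup>2 log n = o(n)\<close>.
  For the resampling chain, two copies agree as soon as all coordinates have been resampled, which fails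
  with probability at most \<open>k (1 - 2/n)\<^sup>t\<close>; conversely all coordinates have been resampled
  with probability at most \<open>(1 - (1 - 2/n)\<^sup>t)\<^sup>k\<close>, and an untouched card is visible since in a uniform
  deck some card is at its original location with probability at most \<open>k / n\<close>.
\<close>

section \<open>The location chain and its comparison with independent resampling\<close>

text \<open>One step of the location chain, written as an operator on test functions;
  \<open>x\<close> holds the locations of the tracked cards. Iterates are then plain
  \<open>^^\<close> powers, and two chains can be compared by sup-norm estimates.\<close>

definition swap_avg :: "nat \<Rightarrow> (nat list \<Rightarrow> real) \<Rightarrow> nat list \<Rightarrow> real" where
  "swap_avg n f x =
     (\<Sum>L\<in>{1..n}. \<Sum>R\<in>{1..n}. f (map (Transposition.transpose L R) x)) / (real n)\<^sup>2"

text \<open>Each coordinate is replaced by a uniform location with probability \<open>2 / n\<close>, since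
  \<open>a div 2\<close> takes each value below \<open>length x\<close> for exactly two \<open>a\<close>; when \<open>a div 2 \<ge> length x\<close>
  the list update does nothing.\<close>

definition resample_avg :: "nat \<Rightarrow> (nat list \<Rightarrow> real) \<Rightarrow> nat list \<Rightarrow> real" where
  "resample_avg n f x =
     (\<Sum>a<n. \<Sum>r\<in>{1..n}. f (x[a div 2 := r])) / (real n)\<^sup>2"

lemma sum_lessThan_div2:
  fixes h :: "nat \<Rightarrow> real"
  assumes "2 * k \<le> n"
  shows "(\<Sum>a<n. h (a div 2)) = 2 * (\<Sum>i<k. h i) + (\<Sum>a\<in>{2*k..<n}. h (a div 2))"
proof -
  have "(\<Sum>a<2*k. h (a div 2)) = 2 * (\<Sum>i<k. h i)"
    by (induction k) auto
  moreover have "{..<n} = {..<2*k} \<union> {2*k..<n}"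
    using assms by auto
  moreover have "(\<Sum>a\<in>{..<2*k} \<union> {2*k..<n}. h (a div 2)) =
      (\<Sum>a<2*k. h (a div 2)) + (\<Sum>a\<in>{2*k..<n}. h (a div 2))"
    by (rule sum.union_disjoint) auto
  ultimately show ?thesis
    by simp
qed

lemma resample_avg_eq:
  assumes "2 * k \<le> n" "length x = k"
  shows "resample_avg n f x =
    (2 * (\<Sum>i<k. \<Sum>r\<in>{1..n}. f (x[i := r])) + (real n - 2 * real k) * real n * f x) / (real n)\<^sup>2"
proof -
  have "(\<Sum>a\<in>{2*k..<n}. \<Sum>r\<in>{1..n}. f (x[a div 2 := r])) = (\<Sum>a\<in>{2*k..<n}. real n * f x)"
  proof (rule sum.cong[OF refl])
    fix a assume "a \<in> {2*k..<n}"
    then have "length x \<le> a div 2" using assms by auto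
    then show "(\<Sum>r\<in>{1..n}. f (x[a div 2 := r])) = real n * f x"
      by (simp add: list_update_beyond)
  qed
  also have "\<dots> = (real n - 2 * real k) * real n * f x"
    using assms by (simp add: of_nat_diff)
  finally show ?thesis
    unfolding resample_avg_def by (subst sum_lessThan_div2[OF assms(1)]) simp
qed

lemma map_transpose_notin:
  assumes "a \<notin> set x" "b \<notin> set x"
  shows "map (Transposition.transpose a b) x = x"
  using assms by (intro map_idI) (auto simp: Transposition.transpose_def)

text \<open>Exchanging an occupied location with a free one changes a single coordinate: this is
  where a swap and a resampling step coincide.\<close>

lemma map_transpose_nth:
  assumes "distinct x" "i < length x" "r \<notin> set x"
  shows "map (Transposition.transpose (x ! i) r) x = x[i := r]"
proof (rule nth_equalityI)
  fix j assume "j < length (map (Transposition.transpose (x ! i) r) x)"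
  then have j: "j < length x" by simp
  then show "map (Transposition.transpose (x ! i) r) x ! j = x[i := r] ! j"
    using assms by (auto simp: Transposition.transpose_def nth_list_update nth_eq_iff_index_eq)
qed simp

lemma sum_set_distinct:
  assumes "distinct x"
  shows "(\<Sum>a\<in>set x. g a) = (\<Sum>i<length x. g (x ! i))"
  using assms by (metis sum.reindex_bij_betw[OF bij_betw_nth])

lemma sum_double_bounds:
  fixes h :: "'a \<Rightarrow> 'b \<Rightarrow> real"
  assumes "finite A" "finite B" "\<And>a b. a \<in> A \<Longrightarrow> b \<in> B \<Longrightarrow> 0 \<le> h a b \<and> h a b \<le> 1"
  shows "0 \<le> (\<Sum>a\<in>A. \<Sum>b\<in>B. h a b)" "(\<Sum>a\<in>A. \<Sum>b\<in>B. h a b) \<le> real (card A) * real (card B)"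
proof -
  show "0 \<le> (\<Sum>a\<in>A. \<Sum>b\<in>B. h a b)"
    using assms by (intro sum_nonneg) auto
  have "(\<Sum>a\<in>A. \<Sum>b\<in>B. h a b) \<le> (\<Sum>a\<in>A. \<Sum>b\<in>B. 1)"
    using assms by (intro sum_mono) auto
  then show "(\<Sum>a\<in>A. \<Sum>b\<in>B. h a b) \<le> real (card A) * real (card B)"
    by simp
qed

text \<open>Pairs \<open>(L, R)\<close> are split by whether each entry lies in \<open>X\<close>,
  the occupied locations, or in \<open>F\<close>, the free ones. The two mixed blocks are exactly
  the resamplings to free locations. Left over are swaps inside \<open>X\<close>, resamplings into
  \<open>X\<close> and a surplus of idle steps, each of order \<open>k^2\<close> out of
  \<open>n^2\<close>.\<close>

lemma swap_avg_resample_avg_close: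
  assumes x: "distinct x" "set x \<subseteq> {1..n}" "length x = k" and k: "2 * k \<le> n"
    and g: "\<And>y. 0 \<le> g y \<and> g y \<le> 1"
  shows "\<bar>swap_avg n g x - resample_avg n g x\<bar> \<le> 2 * (real k)\<^sup>2 / (real n)\<^sup>2"
proof -
  define X F where "X = set x" and "F = {1..n} - X"
  have XF: "finite X" "finite F" "X \<inter> F = {}" "{1..n} = X \<union> F" "card X = k"
    using x by (auto simp: X_def F_def distinct_card)
  have cF: "real (card F) = real n - real k"
  proof -
    have "X \<subseteq> {1..n}" using x by (simp add: X_def)
    then show ?thesis
      using XF card_Diff_subset[of X "{1..n}"] card_mono[of "{1..n}" X] by (simp add: F_def)
  qed
  let ?h = "\<lambda>L R. g (map (Transposition.transpose L R) x)"
  define W where "W = (\<Sum>i<k. \<Sum>r\<in>F. g (x[i := r]))"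
  define XX where "XX = (\<Sum>L\<in>X. \<Sum>R\<in>X. ?h L R)"
  define V where "V = (\<Sum>i<k. \<Sum>r\<in>X. g (x[i := r]))"
  have "(\<Sum>L\<in>X. \<Sum>R\<in>F. ?h L R) = (\<Sum>i<k. \<Sum>R\<in>F. ?h (x ! i) R)"
    using x unfolding X_def by (subst sum_set_distinct) auto
  also have W1: "\<dots> = W"
    unfolding W_def using x by (intro sum.cong refl) (auto simp: map_transpose_nth F_def X_def)
  finally have 1: "(\<Sum>L\<in>X. \<Sum>R\<in>F. ?h L R) = W" .
  then have 2: "(\<Sum>L\<in>F. \<Sum>R\<in>X. ?h L R) = W"
    by (subst sum.swap) (simp add: transpose_commute)
  have 3: "(\<Sum>L\<in>F. \<Sum>R\<in>F. ?h L R) = (real n - real k)\<^sup>2 * g x"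
  proof -
    have "(\<Sum>L\<in>F. \<Sum>R\<in>F. ?h L R) = (\<Sum>L\<in>F. \<Sum>R\<in>F. g x)"
      by (intro sum.cong refl) (auto simp: map_transpose_notin F_def X_def)
    then show ?thesis by (simp add: cF power2_eq_square)
  qed
  have "(\<Sum>L\<in>{1..n}. \<Sum>R\<in>{1..n}. ?h L R) = XX + 2 * W + (real n - real k)\<^sup>2 * g x"
    using XF 1 2 3 by (simp add: sum.union_disjoint sum.distrib XX_def)
  moreover have "(\<Sum>i<k. \<Sum>r\<in>{1..n}. g (x[i := r])) = V + W"
    using XF by (simp add: sum.union_disjoint sum.distrib V_def W_def)
  ultimately have "swap_avg n g x - resample_avg n g x =
      (XX + 2 * W + (real n - real k)\<^sup>2 * g x) / (real n)\<^sup>2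
      - (2 * (V + W) + (real n - 2 * real k) * real n * g x) / (real n)\<^sup>2"
    unfolding swap_avg_def using resample_avg_eq[OF k x(3), of g] by simp
  \<comment> \<open>\<open>W\<close> cancels, and the idle weights differ by
    \<open>(n - k)^2 - (n - 2 * k) * n = k^2\<close>.\<close>
  also have "\<dots> = (XX + (real k)\<^sup>2 * g x - 2 * V) / (real n)\<^sup>2"
    unfolding diff_divide_distrib[symmetric]
    by (rule arg_cong[where f = "\<lambda>z. z / (real n)\<^sup>2"]) (simp add: power2_eq_square algebra_simps)
  finally have eq: "swap_avg n g x - resample_avg n g x =
    (XX + (real k)\<^sup>2 * g x - 2 * V) / (real n)\<^sup>2" .
  have "0 \<le> XX" "XX \<le> (real k)\<^sup>2"
    unfolding XX_def using sum_double_bounds[of X X ?h] XF g by (auto simp: power2_eq_square)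
  moreover have "0 \<le> V" "V \<le> (real k)\<^sup>2"
    unfolding V_def using sum_double_bounds[of "{..<k}" X "\<lambda>i r. g (x[i := r])"] XF g
    by (auto simp: power2_eq_square)
  moreover have "0 \<le> (real k)\<^sup>2 * g x" "(real k)\<^sup>2 * g x \<le> (real k)\<^sup>2"
    using g[of x] by (auto simp: mult_left_le)
  \<comment> \<open>The first two terms lie in \<open>[0, k^2]\<close>, while \<open>2 * V\<close>
    lies in \<open>[0, 2 * k^2]\<close> and has the opposite sign, so the sum stays within
    \<open>2 * k^2\<close> on either side.\<close>
  ultimately have "\<bar>XX + (real k)\<^sup>2 * g x - 2 * V\<bar> \<le> 2 * (real k)\<^sup>2"
    by linarith
  then show ?thesis
    unfolding eq by (simp add: divide_right_mono)
qed

lemma double_avg_mono: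
  fixes h h' :: "'a \<Rightarrow> 'b \<Rightarrow> real"
  assumes "\<And>a b. a \<in> A \<Longrightarrow> b \<in> B \<Longrightarrow> h a b \<le> h' a b"
  shows "(\<Sum>a\<in>A. \<Sum>b\<in>B. h a b) / (real n)\<^sup>2 \<le> (\<Sum>a\<in>A. \<Sum>b\<in>B. h' a b) / (real n)\<^sup>2"
  using assms by (intro divide_right_mono sum_mono) auto

lemma swap_avg_mono:
  assumes "\<And>L R. L \<in> {1..n} \<Longrightarrow> R \<in> {1..n} \<Longrightarrow>
    f (map (Transposition.transpose L R) x) \<le> g (map (Transposition.transpose L R) x)"
  shows "swap_avg n f x \<le> swap_avg n g x"
  unfolding swap_avg_def using assms by (rule double_avg_mono)

lemma swap_avg_diff_const: "n \<ge> 1 \<Longrightarrow> swap_avg n (\<lambda>y. f y - c) x = swap_avg n f x - c"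
  by (simp add: swap_avg_def power2_eq_square sum_subtractf diff_divide_distrib)

lemma resample_avg_le:
  assumes "\<And>a r. a < n \<Longrightarrow> r \<in> {1..n} \<Longrightarrow> f (x[a div 2 := r]) \<le> B a"
  shows "resample_avg n f x \<le> (\<Sum>a<n. B a) / real n"
proof -
  have "resample_avg n f x \<le> (\<Sum>a<n. \<Sum>r\<in>{1..n}. B a) / (real n)\<^sup>2"
    unfolding resample_avg_def using assms by (intro double_avg_mono) auto
  also have "\<dots> = (\<Sum>a<n. B a) / real n"
    by (simp add: power2_eq_square flip: sum_distrib_left)
  finally show ?thesis .
qed

lemma resample_avg_bounds:
  assumes "n \<ge> 1" "\<And>y. 0 \<le> f y \<and> f y \<le> 1"
  shows "0 \<le> resample_avg n f x \<and> resample_avg n f x \<le> 1"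
proof -
  have "0 \<le> (\<Sum>a<n. \<Sum>r\<in>{1..n}. f (x[a div 2 := r]))"
    "(\<Sum>a<n. \<Sum>r\<in>{1..n}. f (x[a div 2 := r])) \<le> (real n)\<^sup>2"
    using sum_double_bounds[of "{..<n}" "{1..n}" "\<lambda>a r. f (x[a div 2 := r])"] assms
    by (auto simp: power2_eq_square)
  then show ?thesis
    using assms by (simp add: resample_avg_def)
qed

lemma resample_avg_iter_bounds:
  assumes "n \<ge> 1" "\<And>y. 0 \<le> f y \<and> f y \<le> 1"
  shows "0 \<le> (resample_avg n ^^ t) f x \<and> (resample_avg n ^^ t) f x \<le> 1"
proof (induction t arbitrary: x)
  case 0
  then show ?case using assms by simp
next
  case (Suc t)
  then show ?case
    using resample_avg_bounds[of n "(resample_avg n ^^ t) f" x] assms(1) by simp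
qed

text \<open>Telescoping: \<open>S^(t+1) - R^(t+1) = S (S^t - R^t) + (S - R) R^t\<close>, with
  \<open>S\<close> the swap step and \<open>R\<close> the resampling step. The order matters: the
  one-step estimate needs distinct entries, which swaps preserve and resampling does not.\<close>

lemma swap_avg_iter_resample_avg_iter_close:
  assumes n: "n \<ge> 1" and k: "2 * k \<le> n" and f: "\<And>y. 0 \<le> f y \<and> f y \<le> 1"
    and x: "distinct x" "set x \<subseteq> {1..n}" "length x = k"
  shows "\<bar>(swap_avg n ^^ t) f x - (resample_avg n ^^ t) f x\<bar> \<le> real t * (2 * (real k)\<^sup>2 / (real n)\<^sup>2)"
  using x
proof (induction t arbitrary: x)
  case 0
  then show ?case by simp
next
  case (Suc t)
  let ?e = "2 * (real k)\<^sup>2 / (real n)\<^sup>2"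
  let ?P = "(swap_avg n ^^ t) f" and ?Q = "(resample_avg n ^^ t) f"
  have close: "\<bar>?P (map (Transposition.transpose L R) x) - ?Q (map (Transposition.transpose L R) x)\<bar>
      \<le> real t * ?e" if "L \<in> {1..n}" "R \<in> {1..n}" for L R
  proof (rule Suc.IH)
    have p: "Transposition.transpose L R permutes {1..n}"
      using that by (rule permutes_swap_id)
    show "distinct (map (Transposition.transpose L R) x)"
      using Suc.prems permutes_inj_on[OF p] by (simp add: distinct_map)
    show "set (map (Transposition.transpose L R) x) \<subseteq> {1..n}"
      using Suc.prems permutes_image[OF p] by auto
  qed (use Suc.prems in simp)
  \<comment> \<open>Monotonicity, together with compatibility with subtracting a constant, carries
    the pointwise bound through one swap step without loss.\<close>
  have "swap_avg n (\<lambda>y. ?P y - real t * ?e) x \<le> swap_avg n ?Q x"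
    using close by (intro swap_avg_mono) force
  moreover have "swap_avg n (\<lambda>y. ?Q y - real t * ?e) x \<le> swap_avg n ?P x"
    using close by (intro swap_avg_mono) force
  ultimately have "\<bar>swap_avg n ?P x - swap_avg n ?Q x\<bar> \<le> real t * ?e"
    unfolding swap_avg_diff_const[OF n] by linarith
  moreover have "\<bar>swap_avg n ?Q x - resample_avg n ?Q x\<bar> \<le> ?e"
    using Suc.prems k resample_avg_iter_bounds[OF n f]
    by (intro swap_avg_resample_avg_close) auto
  ultimately have "\<bar>swap_avg n ?P x - resample_avg n ?Q x\<bar> \<le> real t * ?e + ?e"
    by linarith
  also have "\<dots> = real (Suc t) * ?e"
    unfolding of_nat_Suc distrib_right by simp
  finally show ?case by simp
qed

section \<open>Coupling and coupon collecting for the resampling chain\<close>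

text \<open>Serves two purposes: for two coupled copies it collects the coordinates that have met,
  and against a fixed list it collects the cards standing at prescribed locations.\<close>

definition agreements :: "nat list \<Rightarrow> nat list \<Rightarrow> nat set" where
  "agreements x y = {i. i < length x \<and> x ! i = y ! i}"

lemma finite_agreements [simp]: "finite (agreements x y)"
  by (simp add: agreements_def)

lemma agreements_update_same:
  assumes "i < length x" "length x = length y"
  shows "agreements (x[i := r]) (y[i := r]) = insert i (agreements x y)"
  using assms by (auto simp: agreements_def nth_list_update)

text \<open>Two copies driven by the same choices agree in every coordinate that has been resampled.\<close>

lemma resample_avg_iter_coupling:
  assumes n: "n \<ge> 1" and k: "2 * k \<le> n" and f: "\<And>y. 0 \<le> f y \<and> f y \<le> 1"
    and x: "length x = k" "length y = k"
  shows "(resample_avg n ^^ t) f x - (resample_avg n ^^ t) f y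
    \<le> real (k - card (agreements x y)) * (1 - 2 / real n) ^ t"
  using x
proof (induction t arbitrary: x y)
  case 0
  show ?case
  proof (cases "card (agreements x y) = k")
    case True
    have "agreements x y \<subseteq> {..<k}"
      using 0 by (auto simp: agreements_def)
    then have "agreements x y = {..<k}"
      using True by (simp add: card_subset_eq)
    then have "x = y"
      using 0 by (intro nth_equalityI) (auto simp: agreements_def)
    then show ?thesis by simp
  next
    \<comment> \<open>Some coordinate disagrees, so the right-hand side is at least 1, which bounds
      any difference of two values of \<open>f\<close>.\<close>
    case False
    have "card (agreements x y) \<le> card {..<k}"
      using 0 by (intro card_mono) (auto simp: agreements_def)
    with False have "1 \<le> real (k - card (agreements x y))"
      by simp
    moreover have "f x - f y \<le> 1"
      using f[of x] f[of y] by linarith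
    ultimately show ?thesis by (simp del: of_nat_diff)
  qed
next
  case (Suc t)
  let ?Q = "(resample_avg n ^^ t) f" and ?l = "1 - 2 / real n"
  define A where "A = agreements x y"
  have A: "A \<subseteq> {..<k}" using Suc.prems by (auto simp: A_def agreements_def)
  then have cA: "card A \<le> k" using card_mono[OF _ A] by simp
  \<comment> \<open>The written value \<open>0\<close> is arbitrary: after a common update
    coordinate \<open>i\<close> agrees whatever was written, so the count depends on
    \<open>i\<close> alone.\<close>
  define D where "D = (\<lambda>i. real (k - card (agreements (x[i := 0]) (y[i := 0]))))"
  have D: "real (k - card (agreements (x[i := r]) (y[i := r]))) = D i" for i r
  proof (cases "i < k")
    case True
    then show ?thesis using Suc.prems by (simp add: D_def agreements_update_same)
  qed (use Suc.prems in \<open>simp add: D_def list_update_beyond\<close>)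
  have Dlt: "D i = real (k - card A) - of_bool (i \<notin> A)" if "i < k" for i
  proof -
    have D_insert: "D i = real (k - card (insert i A))"
      using that Suc.prems by (simp only: D_def agreements_update_same A_def)
    show ?thesis
    proof (cases "i \<in> A")
      case True
      then show ?thesis by (simp add: D_insert insert_absorb)
    next
      case False
      then have "card (insert i A) \<le> card {..<k}"
        using A that by (intro card_mono) auto
      then show ?thesis
        using False finite_subset[OF A] by (simp add: D_insert)
    qed
  qed
  have Dge: "D i = real (k - card A)" if "\<not> i < k" for i
    using that Suc.prems by (simp add: D_def A_def list_update_beyond)
  have "(\<Sum>i<k. of_bool (i \<notin> A) :: real) = real (k - card A)"
  proof -
    have "(\<Sum>i<k. of_bool (i \<notin> A) :: real) = (\<Sum>i\<in>{..<k} - A. 1)"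
      by (rule sum.mono_neutral_cong_right) auto
    then show ?thesis using A by (simp add: card_Diff_subset finite_subset)
  qed
  then have "(\<Sum>i<k. D i) = real k * real (k - card A) - real (k - card A)"
    by (simp add: Dlt sum_subtractf)
  moreover have "(\<Sum>a\<in>{2*k..<n}. D (a div 2)) = (\<Sum>a\<in>{2*k..<n}. real (k - card A))"
    by (intro sum.cong refl Dge) auto
  \<comment> \<open>Each coordinate is chosen by two of the \<open>n\<close> values of
    \<open>a\<close>, and only a disagreeing one lowers the count, by one; so
    \<open>2 * (k - card A)\<close> is lost from \<open>n * (k - card A)\<close>.\<close>
  ultimately have sumD: "(\<Sum>a<n. D (a div 2)) = (real n - 2) * real (k - card A)"
    unfolding sum_lessThan_div2[OF k, of D] using k by (simp add: of_nat_diff[OF k] left_diff_distrib)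
  have "resample_avg n ?Q x - resample_avg n ?Q y =
      (\<Sum>a<n. \<Sum>r\<in>{1..n}. ?Q (x[a div 2 := r]) - ?Q (y[a div 2 := r])) / (real n)\<^sup>2"
    by (simp add: resample_avg_def sum_subtractf diff_divide_distrib)
  also have "\<dots> \<le> (\<Sum>a<n. \<Sum>r\<in>{1..n}. D (a div 2) * ?l ^ t) / (real n)\<^sup>2"
  proof (rule double_avg_mono)
    fix a r
    show "?Q (x[a div 2 := r]) - ?Q (y[a div 2 := r]) \<le> D (a div 2) * ?l ^ t"
      using Suc.IH[of "x[a div 2 := r]" "y[a div 2 := r]"] Suc.prems by (simp add: D)
  qed
  also have "\<dots> = real (k - card A) * ?l ^ Suc t"
  proof -
    have "(\<Sum>a<n. \<Sum>r\<in>{1..n}. D (a div 2) * ?l ^ t) = real n * ((\<Sum>a<n. D (a div 2)) * ?l ^ t)"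
      by (simp add: sum_distrib_left sum_distrib_right)
    then show ?thesis
      using n unfolding sumD by (simp add: field_simps power2_eq_square)
  qed
  finally show ?case by (simp add: A_def)
qed

text \<open>The bound is the product over the agreeing coordinates of the probability of being
  resampled: resampling events are negatively correlated, which enters as Bernoulli's inequality.\<close>

lemma resample_avg_iter_no_agreement:
  assumes n: "n \<ge> 2" and k: "2 * k \<le> n" and x: "length x = k"
  shows "(resample_avg n ^^ t) (\<lambda>y. of_bool (agreements y z = {})) x
    \<le> (1 - (1 - 2 / real n) ^ t) ^ card (agreements x z)"
  using x
proof (induction t arbitrary: x)
  case 0
  show ?case by (simp add: of_bool_def)
next
  case (Suc t)
  let ?Q = "(resample_avg n ^^ t) (\<lambda>y. of_bool (agreements y z = {}))" and ?l = "1 - 2 / real n"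
  define A where "A = agreements x z"
  define q where "q = 1 - ?l ^ t"
  define j where "j = card A"
  have q: "0 \<le> q" "q \<le> 1"
    using n by (auto simp: q_def power_le_one)
  have A: "A \<subseteq> {..<k}" using Suc.prems by (auto simp: A_def agreements_def)
  \<comment> \<open>Bound on \<open>?Q\<close> after an update at \<open>i\<close>: an agreeing
    coordinate may lose its agreement, at the cost of one factor \<open>q\<close>. Any other update
    can only add agreements, which improves the inductive bound because
    \<open>q \<le> 1\<close>.\<close>
  define B where "B = (\<lambda>i. if i \<in> A then q ^ (j - 1) else q ^ j)"
  have bd: "?Q (x[i := r]) \<le> B i" for i r
  proof -
    have "A - {i} \<subseteq> agreements (x[i := r]) z"
      by (auto simp: A_def agreements_def nth_list_update)
    then have "card (A - {i}) \<le> card (agreements (x[i := r]) z)"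
      by (intro card_mono) auto
    then have "q ^ card (agreements (x[i := r]) z) \<le> q ^ card (A - {i})"
      using q by (intro power_decreasing) auto
    also have "\<dots> = B i"
      by (auto simp: B_def j_def A_def)
    finally show ?thesis
      using Suc.IH[of "x[i := r]"] Suc.prems by (simp add: q_def)
  qed
  have Blt: "(\<Sum>i<k. B i) = real j * q ^ (j - 1) + (real k - real j) * q ^ j"
  proof -
    have "(\<Sum>i<k. B i) = (\<Sum>i\<in>A. B i) + (\<Sum>i\<in>{..<k} - A. B i)"
      using A by (simp add: sum.subset_diff)
    also have "(\<Sum>i\<in>{..<k} - A. B i) = real (card ({..<k} - A)) * q ^ j"
      by (simp add: B_def)
    also have "real (card ({..<k} - A)) = real k - real j"
      using A card_mono[OF _ A] by (simp add: card_Diff_subset finite_subset j_def of_nat_diff)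
    finally show ?thesis by (simp add: B_def j_def)
  qed
  have "(\<Sum>a\<in>{2*k..<n}. B (a div 2)) = (\<Sum>a\<in>{2*k..<n}. q ^ j)"
    using A by (intro sum.cong refl) (auto simp: B_def)
  then have sumB: "(\<Sum>a<n. B (a div 2)) = (real n - 2 * real j) * q ^ j + 2 * real j * q ^ (j - 1)"
    using k by (subst sum_lessThan_div2[OF k]) (simp add: Blt of_nat_diff algebra_simps)
  have "resample_avg n ?Q x \<le> (\<Sum>a<n. B (a div 2)) / real n"
    by (rule resample_avg_le) (rule bd)
  also have "\<dots> = q ^ j + real j * q ^ (j - 1) * ((1 - q) * (2 / real n))"
  proof (cases j)
    case 0
    then show ?thesis using n by (simp add: sumB)
  next
    case (Suc i)
    then show ?thesis using n unfolding sumB by (simp add: field_simps)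
  qed
  also have "\<dots> \<le> (q + (1 - q) * (2 / real n)) ^ j"
  \<comment> \<open>The left side is the first-order part of the right side in the increment.
    Bernoulli's inequality gives this after division by \<open>q\<close>, so \<open>q = 0\<close> is
    treated apart.\<close>
  proof (cases "q = 0")
    case True
    then show ?thesis using n by (cases j; cases "j - 1") auto
  next
    case False
    have "1 + real j * ((1 - q) * (2 / real n) / q) \<le> (1 + (1 - q) * (2 / real n) / q) ^ j"
      using q n False by (intro Bernoulli_inequality) (auto intro: order_trans[of _ 0])
    then have "q ^ j * (1 + real j * ((1 - q) * (2 / real n) / q))
        \<le> q ^ j * (1 + (1 - q) * (2 / real n) / q) ^ j"
      using q by (intro mult_left_mono) auto
    also have "\<dots> = (q + (1 - q) * (2 / real n)) ^ j"
      unfolding power_mult_distrib[symmetric] using False by (simp add: distrib_left)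
    also have "q ^ j * (1 + real j * ((1 - q) * (2 / real n) / q)) =
        q ^ j + real j * q ^ (j - 1) * ((1 - q) * (2 / real n))"
    proof -
      have "q ^ j * (1 + real j * (c / q)) = q ^ j + real j * q ^ (j - 1) * c" for c
        using False by (cases j) (simp_all add: distrib_left)
      from this[of "(1 - q) * (2 / real n)"] show ?thesis .
    qed
    finally show ?thesis .
  qed
  also have "q + (1 - q) * (2 / real n) = 1 - ?l ^ Suc t"
    by (simp add: q_def algebra_simps)
  finally show ?case by (simp add: A_def j_def)
qed

section \<open>Distance to uniformity\<close>

lemma set_pmf_rtr_step:
  assumes "n \<ge> 1"
  shows "set_pmf (rtr_step n \<sigma>) = (\<lambda>(L, R). \<sigma> \<circ> Transposition.transpose L R) ` ({1..n} \<times> {1..n})"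
  using assms by (simp add: rtr_step_def set_pmf_of_set)

lemma pair_pmf_of_set:
  assumes "finite A" "A \<noteq> {}" "finite B" "B \<noteq> {}"
  shows "pair_pmf (pmf_of_set A) (pmf_of_set B) = pmf_of_set (A \<times> B)"
proof (rule pmf_eqI)
  fix z :: "'a \<times> 'b"
  show "pmf (pair_pmf (pmf_of_set A) (pmf_of_set B)) z = pmf (pmf_of_set (A \<times> B)) z"
    using assms by (cases z) (simp add: pmf_pair indicator_def card_cartesian_product)
qed

text \<open>A transposition is its own inverse, so swapping two locations applies that same
  transposition to every card's location. Hence the tracked locations form a Markov chain of their
  own.\<close>

lemma expectation_rtr_step:
  assumes n: "n \<ge> 1" and \<sigma>: "\<sigma> permutes {1..n}"
  shows "measure_pmf.expectation (rtr_step n \<sigma>) (\<lambda>\<tau>. f (map (inv \<tau>) cs))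
    = swap_avg n f (map (inv \<sigma>) cs)"
proof -
  have inv: "inv (\<sigma> \<circ> Transposition.transpose L R) = Transposition.transpose L R \<circ> inv \<sigma>" for L R
    using permutes_bij[OF \<sigma>] by (simp add: o_inv_distrib)
  have "rtr_step n \<sigma> = map_pmf (\<lambda>(L, R). \<sigma> \<circ> Transposition.transpose L R)
      (pmf_of_set ({1..n} \<times> {1..n}))"
    using n by (simp add: rtr_step_def pair_pmf_of_set)
  then show ?thesis
    using n by (simp add: integral_pmf_of_set case_prod_unfold inv swap_avg_def power2_eq_square
        sum.cartesian_product)
qed

lemma set_pmf_rtr_shuffle:
  assumes n: "n \<ge> 1" and \<sigma>: "\<sigma> permutes {1..n}"
  shows "set_pmf (rtr_shuffle n \<sigma> t) \<subseteq> {\<tau>. \<tau> permutes {1..n}}"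
proof (induction t)
  case 0
  then show ?case using \<sigma> by simp
next
  case (Suc t)
  show ?case
    using Suc n by (auto simp: set_pmf_rtr_step intro!: permutes_compose[OF permutes_swap_id])
qed

text \<open>Backward equation: the last step of the shuffle is absorbed into the test function,
  which is why the induction leaves \<open>f\<close> arbitrary.\<close>

lemma expectation_rtr_shuffle:
  assumes n: "n \<ge> 1" and \<sigma>: "\<sigma> permutes {1..n}"
  shows "measure_pmf.expectation (rtr_shuffle n \<sigma> t) (\<lambda>\<tau>. f (map (inv \<tau>) cs))
    = (swap_avg n ^^ t) f (map (inv \<sigma>) cs)"
proof (induction t arbitrary: f)
  case 0
  then show ?case by simp
next
  case (Suc t)
  let ?\<Pi> = "{\<tau>. \<tau> permutes {1..n}}"
  have fin: "finite ?\<Pi>" by (simp add: finite_permutations)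
  have "measure_pmf.expectation (rtr_shuffle n \<sigma> (Suc t)) (\<lambda>\<tau>. f (map (inv \<tau>) cs))
     = (\<Sum>\<tau>\<in>?\<Pi>. pmf (rtr_shuffle n \<sigma> t) \<tau> *\<^sub>R
          measure_pmf.expectation (rtr_step n \<tau>) (\<lambda>\<tau>. f (map (inv \<tau>) cs)))"
    unfolding rtr_shuffle.simps using set_pmf_rtr_shuffle[OF n \<sigma>]
    by (intro pmf_expectation_bind fin) (simp_all add: set_pmf_rtr_step[OF n])
  also have "\<dots> = (\<Sum>\<tau>\<in>?\<Pi>. pmf (rtr_shuffle n \<sigma> t) \<tau> *\<^sub>R swap_avg n f (map (inv \<tau>) cs))"
    by (intro sum.cong refl arg_cong2[of _ _ _ _ scaleR] expectation_rtr_step n) simp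
  also have "\<dots> = measure_pmf.expectation (rtr_shuffle n \<sigma> t) (\<lambda>\<tau>. swap_avg n f (map (inv \<tau>) cs))"
    using set_pmf_rtr_shuffle[OF n \<sigma>] by (intro integral_measure_pmf[OF fin, symmetric]) blast
  also have "\<dots> = (swap_avg n ^^ Suc t) f (map (inv \<sigma>) cs)"
    unfolding Suc.IH funpow_Suc_right o_apply ..
  finally show ?case .
qed

lemma prob_location_law:
  "measure_pmf.prob (location_law cs p) A =
    measure_pmf.expectation p (\<lambda>\<tau>. indicator A (map (inv \<tau>) cs))"
proof -
  have "measure_pmf.prob (location_law cs p) A =
      measure_pmf.expectation (location_law cs p) (indicator A)"
    by simp
  then show ?thesis by (simp only: location_law_def integral_map_pmf)
qed

section \<open>Averages over a uniform deck\<close>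

definition perm_avg :: "nat \<Rightarrow> nat list \<Rightarrow> (nat list \<Rightarrow> real) \<Rightarrow> real" where
  "perm_avg n cs f = (\<Sum>\<tau> | \<tau> permutes {1..n}. f (map (inv \<tau>) cs)) / fact n"

lemma permutations_finite_nonempty:
  "finite {\<tau>. \<tau> permutes {1..n::nat}}" "{\<tau>. \<tau> permutes {1..n::nat}} \<noteq> {}"
  using finite_permutations[of "{1..n}"] permutes_id[of "{1..n}"]
  by (simp_all only: finite_atLeastAtMost Collect_empty_eq) (auto simp only:)

lemma card_permutations_interval: "card {\<tau>. \<tau> permutes {1..n::nat}} = fact n"
  by (simp add: card_permutations)

lemma expectation_uniform_perm:
  "measure_pmf.expectation (uniform_perm n) (\<lambda>\<tau>. f (map (inv \<tau>) cs)) = perm_avg n cs f"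
  unfolding uniform_perm_def perm_avg_def
    integral_pmf_of_set[OF permutations_finite_nonempty(2,1)] card_permutations_interval by simp

lemma perm_avg_const: "perm_avg n cs (\<lambda>_. c) = c"
  by (simp add: perm_avg_def card_permutations_interval del: One_nat_def)

lemma perm_avg_mono:
  assumes "\<And>\<tau>. \<tau> permutes {1..n} \<Longrightarrow> f (map (inv \<tau>) cs) \<le> g (map (inv \<tau>) cs)"
  shows "perm_avg n cs f \<le> perm_avg n cs g"
  unfolding perm_avg_def using assms by (intro divide_right_mono sum_mono) auto

lemma perm_avg_diff: "perm_avg n cs (\<lambda>x. f x - g x) = perm_avg n cs f - perm_avg n cs g"
  by (simp add: perm_avg_def sum_subtractf diff_divide_distrib)

text \<open>Stationarity: for fixed \<open>L\<close> and \<open>R\<close>, composition with the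
  transposition is a bijection of the set of decks, so the sum over all decks does not
  change.\<close>

lemma perm_avg_swap_avg:
  assumes n: "n \<ge> 1"
  shows "perm_avg n cs (swap_avg n f) = perm_avg n cs f"
proof -
  let ?\<Pi> = "{\<tau>. \<tau> permutes {1..n}}"
  have *: "(\<Sum>\<tau>\<in>?\<Pi>. f (map (Transposition.transpose L R) (map (inv \<tau>) cs)))
      = (\<Sum>\<tau>\<in>?\<Pi>. f (map (inv \<tau>) cs))" if "L \<in> {1..n}" "R \<in> {1..n}" for L R
  proof -
    have "(\<Sum>\<tau>\<in>?\<Pi>. f (map (inv \<tau>) cs))
        = (\<Sum>\<tau>\<in>?\<Pi>. f (map (inv (\<tau> \<circ> Transposition.transpose L R)) cs))"
      using that by (intro sum_permutations_compose_right permutes_swap_id)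
    also have "\<dots> = (\<Sum>\<tau>\<in>?\<Pi>. f (map (Transposition.transpose L R) (map (inv \<tau>) cs)))"
    proof (rule sum.cong[OF refl])
      fix \<tau> assume "\<tau> \<in> ?\<Pi>"
      then have "bij \<tau>" by (auto dest: permutes_bij)
      then show "f (map (inv (\<tau> \<circ> Transposition.transpose L R)) cs)
          = f (map (Transposition.transpose L R) (map (inv \<tau>) cs))"
        by (simp add: o_inv_distrib)
    qed
    finally show ?thesis by simp
  qed
  let ?g = "\<lambda>\<tau> L R. f (map (Transposition.transpose L R) (map (inv \<tau>) cs))"
  have "(\<Sum>\<tau>\<in>?\<Pi>. swap_avg n f (map (inv \<tau>) cs)) =
      (\<Sum>\<tau>\<in>?\<Pi>. \<Sum>L\<in>{1..n}. \<Sum>R\<in>{1..n}. ?g \<tau> L R) / (real n)\<^sup>2"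
    unfolding swap_avg_def sum_divide_distrib[symmetric] ..
  also have "(\<Sum>\<tau>\<in>?\<Pi>. \<Sum>L\<in>{1..n}. \<Sum>R\<in>{1..n}. ?g \<tau> L R) =
      (\<Sum>L\<in>{1..n}. \<Sum>\<tau>\<in>?\<Pi>. \<Sum>R\<in>{1..n}. ?g \<tau> L R)"
    by (rule sum.swap)
  also have "\<dots> = (\<Sum>L\<in>{1..n}. \<Sum>R\<in>{1..n}. \<Sum>\<tau>\<in>?\<Pi>. ?g \<tau> L R)"
    by (intro sum.cong refl sum.swap)
  also have "\<dots> = (\<Sum>L\<in>{1..n}. \<Sum>R\<in>{1..n}. \<Sum>\<tau>\<in>?\<Pi>. f (map (inv \<tau>) cs))"
    by (intro sum.cong refl *)
  also have "\<dots> / (real n)\<^sup>2 = (\<Sum>\<tau>\<in>?\<Pi>. f (map (inv \<tau>) cs))"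
    using n by (simp add: power2_eq_square)
  finally show ?thesis by (simp add: perm_avg_def)
qed

lemma perm_avg_swap_avg_iter:
  assumes "n \<ge> 1"
  shows "perm_avg n cs ((swap_avg n ^^ t) f) = perm_avg n cs f"
  by (induction t) (simp_all add: perm_avg_swap_avg[OF assms])

text \<open>Symmetry: composing with the transposition of \<open>z\<close> and \<open>z'\<close>
  matches the decks having card \<open>c\<close> at \<open>z\<close> with those having it at
  \<open>z'\<close>. The \<open>n\<close> equal frequencies add up to one.\<close>

lemma perm_avg_location:
  assumes n: "c \<in> {1..n}" "z \<in> {1..n}"
  shows "(\<Sum>\<tau> | \<tau> permutes {1..n}. of_bool (inv \<tau> c = z)) / (fact n :: real) = 1 / real n"
proof -
  let ?\<Pi> = "{\<tau>. \<tau> permutes {1..n}}"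
  let ?N = "\<lambda>z. \<Sum>\<tau>\<in>?\<Pi>. of_bool (inv \<tau> c = z) :: real"
  have eq: "?N z' = ?N z" if "z' \<in> {1..n}" for z'
  proof -
    have "?N z' = (\<Sum>\<tau>\<in>?\<Pi>. of_bool (inv (\<tau> \<circ> Transposition.transpose z z') c = z'))"
      using that n by (intro sum_permutations_compose_right permutes_swap_id)
    also have "\<dots> = ?N z"
    proof (rule sum.cong[OF refl])
      fix \<tau> assume "\<tau> \<in> ?\<Pi>"
      then have "bij \<tau>" by (auto dest: permutes_bij)
      then show "of_bool (inv (\<tau> \<circ> Transposition.transpose z z') c = z')
          = (of_bool (inv \<tau> c = z) :: real)"
        by (auto simp: o_inv_distrib Transposition.transpose_def)
    qed
    finally show ?thesis .
  qed
  have "real n * ?N z = (\<Sum>z'\<in>{1..n}. ?N z')"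
    using eq by simp
  also have "\<dots> = (\<Sum>\<tau>\<in>?\<Pi>. \<Sum>z'\<in>{1..n}. of_bool (inv \<tau> c = z'))"
    by (rule sum.swap)
  also have "\<dots> = (\<Sum>\<tau>\<in>?\<Pi>. 1)"
  proof (rule sum.cong[OF refl])
    fix \<tau> assume "\<tau> \<in> ?\<Pi>"
    then have "inv \<tau> permutes {1..n}"
      by (simp add: permutes_inv)
    then have "inv \<tau> c \<in> {1..n}"
      using n(1) permutes_in_image by metis
    then show "(\<Sum>z'\<in>{1..n}. of_bool (inv \<tau> c = z')) = (1 :: real)"
      by (simp add: of_bool_def del: One_nat_def)
  qed
  also have "\<dots> = fact n"
    by (simp add: card_permutations_interval del: One_nat_def)
  finally show ?thesis
    using n by (simp add: field_simps)
qed

text \<open>Union bound: each listed card meets its prescribed location with probability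
  \<open>1 / n\<close>.\<close>

lemma perm_avg_no_agreement:
  assumes "set cs \<subseteq> {1..n}" "set z \<subseteq> {1..n}" "length z = length cs"
  shows "perm_avg n cs (\<lambda>y. of_bool (agreements y z = {})) \<ge> 1 - real (length cs) / real n"
proof -
  let ?k = "length cs"
  have "1 - perm_avg n cs (\<lambda>y. of_bool (agreements y z = {}))
      = perm_avg n cs (\<lambda>y. 1 - of_bool (agreements y z = {}))"
    by (simp add: perm_avg_diff perm_avg_const)
  also have "\<dots> \<le> (\<Sum>\<tau> | \<tau> permutes {1..n}. \<Sum>i<?k. of_bool (inv \<tau> (cs ! i) = z ! i)) / fact n"
    unfolding perm_avg_def
  proof (intro divide_right_mono sum_mono)
    fix \<tau>
    show "1 - of_bool (agreements (map (inv \<tau>) cs) z = {})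
        \<le> (\<Sum>i<?k. of_bool (inv \<tau> (cs ! i) = z ! i) :: real)"
    proof (cases "agreements (map (inv \<tau>) cs) z = {}")
      case False
      then obtain i where i: "i < ?k" "inv \<tau> (cs ! i) = z ! i"
        by (auto simp: agreements_def)
      then have "(of_bool (inv \<tau> (cs ! i) = z ! i) :: real) \<le>
          (\<Sum>i<?k. of_bool (inv \<tau> (cs ! i) = z ! i))"
        by (intro member_le_sum) auto
      then show ?thesis using i False by simp
    qed (simp add: sum_nonneg)
  qed simp
  also have "\<dots> = (\<Sum>i<?k. (\<Sum>\<tau> | \<tau> permutes {1..n}. of_bool (inv \<tau> (cs ! i) = z ! i)) / fact n)"
    by (subst sum.swap) (simp add: sum_divide_distrib)
  also have "\<dots> = (\<Sum>i<?k. 1 / real n)"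
    using assms by (intro sum.cong refl perm_avg_location) (auto simp: subset_iff)
  finally show ?thesis by simp
qed

section \<open>Total variation bounds for a fixed list of cards\<close>

lemma tv_dist_upper:
  assumes "\<And>A. \<bar>measure_pmf.prob p A - measure_pmf.prob q A\<bar> \<le> e"
  shows "tv_dist p q \<le> e"
  unfolding tv_dist_def using assms by (intro cSUP_least) auto

lemma abs_prob_diff_le_1: "\<bar>measure_pmf.prob p A - measure_pmf.prob q A\<bar> \<le> 1"
  using measure_pmf.prob_le_1[of p A] measure_pmf.prob_le_1[of q A]
    measure_nonneg[of p A] measure_nonneg[of q A] by linarith

lemma tv_dist_lower: "\<bar>measure_pmf.prob p A - measure_pmf.prob q A\<bar> \<le> tv_dist p q"
  unfolding tv_dist_def
  by (intro cSUP_upper) (auto intro!: bdd_aboveI[of _ 1] abs_prob_diff_le_1)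

text \<open>Only the last \<open>m\<close> steps are compared with resampling; the first
  \<open>t - m\<close> steps merely randomise the deck from which these start, and the estimate is
  uniform in that deck. The comparison error grows with \<open>m\<close>, so keeping
  \<open>m\<close> below \<open>t\<close> makes the bound useful at arbitrarily late times.\<close>

lemma tv_dist_rtr_shuffle_upper:
  assumes n: "n \<ge> 1" and k: "2 * k \<le> n" and cs: "distinct cs" "set cs \<subseteq> {1..n}" "length cs = k"
    and \<sigma>: "\<sigma> permutes {1..n}" and m: "m \<le> t"
  shows "tv_dist (location_law cs (rtr_shuffle n \<sigma> t)) (location_law cs (uniform_perm n))
    \<le> real k * (1 - 2 / real n) ^ m + 4 * (real k)\<^sup>2 * real m / (real n)\<^sup>2"
proof (rule tv_dist_upper)
  fix A :: "nat list set"
  let ?f = "indicator A :: nat list \<Rightarrow> real"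
  let ?P = "(swap_avg n ^^ m) ?f" and ?Q = "(resample_avg n ^^ m) ?f"
  let ?X = "\<lambda>\<tau>. map (inv \<tau>) cs"
  define e where "e = real k * (1 - 2 / real n) ^ m + 4 * (real k)\<^sup>2 * real m / (real n)\<^sup>2"
  have f: "0 \<le> ?f y \<and> ?f y \<le> 1" for y
    by (simp add: indicator_def)
  have X: "distinct (?X \<tau>)" "set (?X \<tau>) \<subseteq> {1..n}" "length (?X \<tau>) = k"
    if "\<tau> permutes {1..n}" for \<tau>
    using cs permutes_inj_on[OF permutes_inv[OF that]] permutes_in_image[OF permutes_inv[OF that]]
    by (auto simp: distinct_map)
  \<comment> \<open>For \<open>n = 1\<close> the base is \<open>-1\<close>, but then
    \<open>k = 0\<close> and the term vanishes.\<close>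
  have l: "0 \<le> 1 - 2 / real n" if "k > 0"
    using k that by auto
  have coup: "?Q x - ?Q y \<le> real k * (1 - 2 / real n) ^ m" if "length x = k" "length y = k" for x y
  proof -
    have "real (k - card (agreements x y)) * (1 - 2 / real n) ^ m \<le> real k * (1 - 2 / real n) ^ m"
      using l by (cases "k = 0") (auto intro!: mult_right_mono)
    then show ?thesis
      using resample_avg_iter_coupling[where f = ?f and t = m, OF n k f that] by linarith
  qed
  \<comment> \<open>Each of the two decks needs its own passage to the resampling chain; this
    doubles the comparison error and gives the constant \<open>4\<close>.\<close>
  have pair: "?P (?X \<tau>) - ?P (?X \<tau>') \<le> e" if "\<tau> permutes {1..n}" "\<tau>' permutes {1..n}" for \<tau> \<tau>'
  proof -
    let ?b = "real m * (2 * (real k)\<^sup>2 / (real n)\<^sup>2)"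
    have "\<bar>?P (?X \<tau>) - ?Q (?X \<tau>)\<bar> \<le> ?b"
      by (rule swap_avg_iter_resample_avg_iter_close[OF n k f X[OF that(1)]])
    moreover have "\<bar>?P (?X \<tau>') - ?Q (?X \<tau>')\<bar> \<le> ?b"
      by (rule swap_avg_iter_resample_avg_iter_close[OF n k f X[OF that(2)]])
    moreover have "?Q (?X \<tau>) - ?Q (?X \<tau>') \<le> real k * (1 - 2 / real n) ^ m"
      by (rule coup[OF X(3)[OF that(1)] X(3)[OF that(2)]])
    moreover have "e = real k * (1 - 2 / real n) ^ m + 2 * ?b"
      by (simp add: e_def)
    ultimately show ?thesis by linarith
  qed
  \<comment> \<open>Averaging over the second deck replaces it by the uniform average, which the
    swap chain preserves; the stationary law of the resampling chain never enters.\<close>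
  have "\<bar>?P (?X \<tau>) - perm_avg n cs ?P\<bar> \<le> e" if \<tau>: "\<tau> permutes {1..n}" for \<tau>
  proof -
    have "perm_avg n cs (\<lambda>y. ?P (?X \<tau>) - ?P y) \<le> perm_avg n cs (\<lambda>_. e)"
      by (intro perm_avg_mono pair \<tau>)
    moreover have "perm_avg n cs (\<lambda>y. ?P y - ?P (?X \<tau>)) \<le> perm_avg n cs (\<lambda>_. e)"
      by (intro perm_avg_mono pair \<tau>)
    ultimately show ?thesis
      unfolding perm_avg_diff perm_avg_const by linarith
  qed
  then have e: "\<bar>?P (?X \<tau>) - perm_avg n cs ?f\<bar> \<le> e" if "\<tau> permutes {1..n}" for \<tau>
    using that by (simp add: perm_avg_swap_avg_iter[OF n])
  let ?p = "rtr_shuffle n \<sigma> (t - m)"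
  have "(swap_avg n ^^ t) ?f (?X \<sigma>) = (swap_avg n ^^ (t - m)) ?P (?X \<sigma>)"
  proof -
    have "swap_avg n ^^ t = (swap_avg n ^^ (t - m)) \<circ> (swap_avg n ^^ m)"
      using m by (simp flip: funpow_add)
    then show ?thesis by simp
  qed
  also have "\<dots> = measure_pmf.expectation ?p (\<lambda>\<tau>. ?P (?X \<tau>))"
    by (rule expectation_rtr_shuffle[OF n \<sigma>, symmetric])
  finally have E: "(swap_avg n ^^ t) ?f (?X \<sigma>) = measure_pmf.expectation ?p (\<lambda>\<tau>. ?P (?X \<tau>))" .
  have int: "integrable ?p (g :: _ \<Rightarrow> real)" for g
    using finite_subset[OF set_pmf_rtr_shuffle[OF n \<sigma>]] permutations_finite_nonempty(1)
    by (intro integrable_measure_pmf_finite) blast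
  have AE: "AE \<tau> in ?p. \<tau> permutes {1..n}"
    using set_pmf_rtr_shuffle[OF n \<sigma>] by (auto simp: AE_measure_pmf_iff)
  have "measure_pmf.expectation ?p (\<lambda>\<tau>. ?P (?X \<tau>)) \<le> perm_avg n cs ?f + e"
    using e by (intro measure_pmf.integral_le_const int) (use AE in eventually_elim, force)
  moreover have "measure_pmf.expectation ?p (\<lambda>\<tau>. ?P (?X \<tau>)) \<ge> perm_avg n cs ?f - e"
    using e by (intro measure_pmf.integral_ge_const int) (use AE in eventually_elim, force)
  ultimately have "\<bar>(swap_avg n ^^ t) ?f (?X \<sigma>) - perm_avg n cs ?f\<bar> \<le> e"
    unfolding E by linarith
  then show "\<bar>measure_pmf.prob (location_law cs (rtr_shuffle n \<sigma> t)) A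
      - measure_pmf.prob (location_law cs (uniform_perm n)) A\<bar>
      \<le> real k * (1 - 2 / real n) ^ m + 4 * (real k)\<^sup>2 * real m / (real n)\<^sup>2"
    unfolding prob_location_law expectation_rtr_shuffle[OF n \<sigma>] expectation_uniform_perm e_def .
qed

text \<open>From \<open>id\<close> every card starts at the location equal to its label. The test
  event is that no tracked card stands at its starting location: unlikely until all coordinates have
  been resampled, but of probability at least \<open>1 - k / n\<close> in a uniform deck.\<close>

lemma tv_dist_rtr_shuffle_lower:
  assumes n: "n \<ge> 2" and k: "2 * k \<le> n" and cs: "distinct cs" "set cs \<subseteq> {1..n}" "length cs = k"
  shows "tv_dist (location_law cs (rtr_shuffle n id t)) (location_law cs (uniform_perm n))
    \<ge> 1 - (1 - (1 - 2 / real n) ^ t) ^ k - 2 * (real k)\<^sup>2 * real t / (real n)\<^sup>2 - real k / real n"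
proof -
  let ?A = "{y. agreements y cs = {}}"
  let ?f = "\<lambda>y. of_bool (agreements y cs = {}) :: real"
  have n1: "n \<ge> 1" using n by simp
  have f: "indicator ?A = ?f"
    by (auto simp: indicator_def)
  have "agreements cs cs = {..<k}"
    using cs by (auto simp: agreements_def)
  then have "(resample_avg n ^^ t) ?f cs \<le> (1 - (1 - 2 / real n) ^ t) ^ k"
    using resample_avg_iter_no_agreement[OF n k cs(3), of t cs] by simp
  moreover have "\<bar>(swap_avg n ^^ t) ?f cs - (resample_avg n ^^ t) ?f cs\<bar>
      \<le> real t * (2 * (real k)\<^sup>2 / (real n)\<^sup>2)"
    by (rule swap_avg_iter_resample_avg_iter_close[OF n1 k _ cs]) simp
  moreover have "real t * (2 * (real k)\<^sup>2 / (real n)\<^sup>2) = 2 * (real k)\<^sup>2 * real t / (real n)\<^sup>2"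
    by simp
  moreover have "perm_avg n cs ?f \<ge> 1 - real k / real n"
    using perm_avg_no_agreement[of cs n cs] cs by simp
  moreover have "measure_pmf.prob (location_law cs (rtr_shuffle n id t)) ?A = (swap_avg n ^^ t) ?f cs"
    unfolding prob_location_law f
    using expectation_rtr_shuffle[OF n1 permutes_id, of t ?f cs] by simp
  moreover have "measure_pmf.prob (location_law cs (uniform_perm n)) ?A = perm_avg n cs ?f"
    unfolding prob_location_law f
    using expectation_uniform_perm[where f = ?f] by simp
  ultimately show ?thesis
    using tv_dist_lower[of "location_law cs (rtr_shuffle n id t)" ?A "location_law cs (uniform_perm n)"]
    by linarith
qed

section \<open>From fixed cards to the maximum over cards and decks\<close>

lemma finite_enumerations: "finite {cs. distinct cs \<and> set cs \<in> card_sets n k}"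
proof (rule finite_subset)
  show "{cs. distinct cs \<and> set cs \<in> card_sets n k} \<subseteq> {cs. set cs \<subseteq> {1..n} \<and> length cs = k}"
    by (auto simp: card_sets_def distinct_card)
qed (simp add: finite_lists_length_eq)

lemma max_partial_dist_upper:
  assumes n: "k \<le> n"
    and "\<And>cs \<sigma>. distinct cs \<Longrightarrow> set cs \<subseteq> {1..n} \<Longrightarrow> length cs = k \<Longrightarrow> \<sigma> permutes {1..n} \<Longrightarrow>
      tv_dist (location_law cs (S n \<sigma> (nat \<lfloor>t\<rfloor>))) (location_law cs (uniform_perm n)) \<le> e"
  shows "max_partial_dist S n k t \<le> e"
proof -
  \<comment> \<open>Bounding the maximum from above requires a nonempty set of enumerations, and
    \<open>k \<le> n\<close> provides a member.\<close>
  have "set [1..<Suc k] = {1..k}"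
    by auto
  then have "[1..<Suc k] \<in> {cs. distinct cs \<and> set cs \<in> card_sets n k}"
    using n unfolding card_sets_def mem_Collect_eq by (metis atLeastatMost_subset_iff card_atLeastAtMost
      diff_Suc_1 distinct_upt order_refl)
  moreover have "partial_dist S n cs t \<le> e" if "distinct cs" "set cs \<in> card_sets n k" for cs
    unfolding partial_dist_def using assms(2)[of cs] that permutations_finite_nonempty
    by (subst Max_le_iff) (auto simp: card_sets_def distinct_card)
  ultimately show ?thesis
    unfolding max_partial_dist_def using finite_enumerations
    by (subst Max_le_iff) blast+
qed

lemma max_partial_dist_lower:
  assumes "distinct cs" "set cs \<subseteq> {1..n}" "length cs = k" "\<sigma> permutes {1..n}"
  shows "tv_dist (location_law cs (S n \<sigma> (nat \<lfloor>t\<rfloor>))) (location_law cs (uniform_perm n))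
    \<le> max_partial_dist S n k t"
proof -
  have "tv_dist (location_law cs (S n \<sigma> (nat \<lfloor>t\<rfloor>))) (location_law cs (uniform_perm n))
      \<le> partial_dist S n cs t"
    unfolding partial_dist_def using assms permutations_finite_nonempty by (intro Max_ge) auto
  also have "\<dots> \<le> max_partial_dist S n k t"
    unfolding max_partial_dist_def using assms finite_enumerations
    by (intro Max_ge finite_imageI imageI) (auto simp: card_sets_def distinct_card)
  finally show ?thesis .
qed

lemma max_partial_dist_rtr_upper:
  assumes "n \<ge> 1" "2 * k \<le> n" "m \<le> nat \<lfloor>t\<rfloor>"
  shows "max_partial_dist rtr_shuffle n k t
    \<le> real k * (1 - 2 / real n) ^ m + 4 * (real k)\<^sup>2 * real m / (real n)\<^sup>2"
proof (rule max_partial_dist_upper)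
  show "k \<le> n" using assms by simp
qed (rule tv_dist_rtr_shuffle_upper[OF assms(1,2) _ _ _ _ assms(3)])

lemma max_partial_dist_rtr_lower:
  assumes "n \<ge> 2" "2 * k \<le> n" "m = nat \<lfloor>t\<rfloor>"
  shows "max_partial_dist rtr_shuffle n k t
    \<ge> 1 - (1 - (1 - 2 / real n) ^ m) ^ k - 2 * (real k)\<^sup>2 * real m / (real n)\<^sup>2 - real k / real n"
proof -
  have cs: "distinct [1..<Suc k]" "set [1..<Suc k] \<subseteq> {1..n}" "length [1..<Suc k] = k"
    using assms by auto
  show ?thesis
    unfolding assms(3)
    by (rule order_trans[OF tv_dist_rtr_shuffle_lower[OF assms(1,2) cs]
      max_partial_dist_lower[where S = rtr_shuffle, OF cs permutes_id]])
qed

lemma max_partial_dist_nonneg: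
  assumes "k \<le> n"
  shows "0 \<le> max_partial_dist S n k t"
proof -
  have cs: "distinct [1..<Suc k]" "set [1..<Suc k] \<subseteq> {1..n}" "length [1..<Suc k] = k"
    using assms by auto
  show ?thesis
    by (rule order_trans[OF order_trans[OF abs_ge_zero tv_dist_lower]
      max_partial_dist_lower[OF cs permutes_id]])
qed

lemma max_partial_dist_le_1:
  assumes "k \<le> n"
  shows "max_partial_dist S n k t \<le> 1"
  using assms by (intro max_partial_dist_upper tv_dist_upper abs_prob_diff_le_1)

section \<open>Asymptotics\<close>

text \<open>Rounding \<open>s\<close> down to an integer costs a factor of at most
  \<open>exp (2 / n)\<close>, hence at most \<open>exp 1\<close> for \<open>n \<ge> 2\<close>; this
  is the \<open>1\<close> in the exponent. The free \<open>s\<close> makes the bound uniform over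
  all later times \<open>t\<close>.\<close>

lemma max_partial_dist_rtr_exp_upper:
  assumes k: "k \<ge> 1" "2 * k \<le> n" and s: "0 \<le> s" "s \<le> t"
  shows "max_partial_dist rtr_shuffle n k t
    \<le> real k * exp (1 - 2 * s / real n) + 4 * (real k)\<^sup>2 * s / (real n)\<^sup>2"
proof -
  define m where "m = nat \<lfloor>s\<rfloor>"
  have n: "n \<ge> 2" using k by simp
  have m: "m \<le> nat \<lfloor>t\<rfloor>" "real m \<le> s" "s - 1 \<le> real m"
    using s by (auto simp: m_def nat_mono floor_mono)
  have "(1 - 2 / real n) ^ m \<le> exp (- 2 / real n) ^ m"
    using n exp_ge_add_one_self[of "- 2 / real n"] by (intro power_mono) auto
  also have "\<dots> = exp (- 2 * real m / real n)"
    by (simp flip: exp_of_nat_mult add: mult.commute)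
  also have "\<dots> \<le> exp (1 - 2 * s / real n)"
  proof -
    have "2 * s \<le> real n + 2 * real m" using m n by simp
    then show ?thesis using n by (simp add: field_simps)
  qed
  finally have "real k * (1 - 2 / real n) ^ m \<le> real k * exp (1 - 2 * s / real n)"
    by (intro mult_left_mono) auto
  moreover have "4 * (real k)\<^sup>2 * real m / (real n)\<^sup>2 \<le> 4 * (real k)\<^sup>2 * s / (real n)\<^sup>2"
    using m by (intro divide_right_mono mult_left_mono) auto
  ultimately show ?thesis
    using max_partial_dist_rtr_upper[of n k m t] n k m by linarith
qed

text \<open>The bound decreases in the number of steps, so any nonnegative \<open>s\<close> above
  \<open>t\<close> may replace it, even when \<open>t\<close> is negative. The product over cards is
  handled by \<open>(1 - p)^k \<le> exp (- k * p)\<close>.\<close>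

lemma max_partial_dist_rtr_exp_lower:
  assumes n: "n \<ge> 4" and k: "2 * k \<le> n" and s: "0 \<le> s" "t \<le> s"
  shows "max_partial_dist rtr_shuffle n k t
    \<ge> 1 - exp (- (real k * exp (- (2 / real n + 8 / (real n)\<^sup>2) * s)))
      - 2 * (real k)\<^sup>2 * s / (real n)\<^sup>2 - real k / real n"
proof -
  define m where "m = nat \<lfloor>t\<rfloor>"
  let ?l = "1 - 2 / real n" and ?c = "2 / real n + 8 / (real n)\<^sup>2"
  have m: "real m \<le> s"
    using s by (simp add: m_def) linarith
  have l: "0 < ?l" "?l \<le> 1" using n by auto
  \<comment> \<open>This is \<open>ln (1 - x) \<ge> - x - 2 * x^2\<close> at
    \<open>x = 2 / n\<close>, valid up to \<open>x = 1 / 2\<close>, hence \<open>n \<ge> 4\<close>;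
    the square produces the \<open>8 / n^2\<close> in \<open>?c\<close>.\<close>
  have "- (2 / real n) - 2 * (2 / real n)\<^sup>2 \<le> ln ?l"
    using n by (intro ln_one_minus_pos_lower_bound) (auto simp: field_simps)
  then have "- ?c \<le> ln ?l"
    by (simp add: power_divide)
  then have "exp (- ?c) \<le> ?l"
    using l by (metis exp_ln exp_le_cancel_iff)
  then have "exp (- ?c) ^ m \<le> ?l ^ m"
    by (intro power_mono) auto
  moreover have "exp (- ?c) ^ m = exp (- ?c * real m)"
    by (simp flip: exp_of_nat_mult add: mult.commute)
  moreover have "- ?c * s \<le> - ?c * real m"
  proof (rule mult_left_mono_neg)
    have "0 \<le> ?c" by (intro add_nonneg_nonneg) auto
    then show "- ?c \<le> 0" by linarith
  qed (rule m)
  then have "exp (- ?c * s) \<le> exp (- ?c * real m)"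
    by (simp only: exp_le_cancel_iff)
  ultimately have lm: "exp (- ?c * s) \<le> ?l ^ m"
    by linarith
  have "(1 - ?l ^ m) ^ k \<le> exp (- (?l ^ m)) ^ k"
    using l exp_ge_add_one_self[of "- (?l ^ m)"] by (intro power_mono) (auto simp: power_le_one)
  also have "\<dots> = exp (- (real k * ?l ^ m))"
    by (simp flip: exp_of_nat_mult)
  also have "\<dots> \<le> exp (- (real k * exp (- ?c * s)))"
    using lm by (auto intro!: mult_left_mono)
  finally have "(1 - ?l ^ m) ^ k \<le> exp (- (real k * exp (- ?c * s)))" .
  moreover have "2 * (real k)\<^sup>2 * real m / (real n)\<^sup>2 \<le> 2 * (real k)\<^sup>2 * s / (real n)\<^sup>2"
    using m by (intro divide_right_mono mult_left_mono) auto
  ultimately show ?thesis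
    using max_partial_dist_rtr_lower[of n k m t] n k m_def by linarith
qed

section \<open>Growing \<open>k\<close> with cutoff, bounded \<open>k\<close> without\<close>

lemma rtr_partial_cutoff:
  fixes k :: "nat \<Rightarrow> nat"
  assumes k_range: "\<forall>n\<ge>1. k n \<in> {1..n}"
    and k_small: "(\<lambda>n. real (k n)) \<in> o(\<lambda>n. (real n / ln (real n)) powr (1 / 2))"
    and k_top: "filterlim k at_top sequentially"
  shows "partial_cutoff rtr_shuffle k (\<lambda>n. 0.5 * real n * ln (real (k n))) (\<lambda>n. if n = 0 then 1 else real n)"
proof -
  define d where "d = (\<lambda>\<alpha> n. max_partial_dist rtr_shuffle n (k n)
    (0.5 * real n * ln (real (k n)) + \<alpha> * (if n = 0 then 1 else real n)))"
  \<comment> \<open>For large \<open>n\<close> this is the square of the ratio in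
    \<open>k_small\<close>, so it tends to 0; every error term below is bounded by a multiple of
    it.\<close>
  define b where "b = (\<lambda>n. (real (k n))\<^sup>2 * ln (real n) / real n)"
  have "(\<lambda>n. (real (k n) / (real n / ln (real n)) powr (1 / 2))\<^sup>2) \<longlonglongrightarrow> 0\<^sup>2"
    by (intro tendsto_power smalloD_tendsto[OF k_small])
  moreover have "eventually (\<lambda>n. (real (k n) / (real n / ln (real n)) powr (1 / 2))\<^sup>2 = b n) sequentially"
    using eventually_ge_at_top[of 3]
  proof eventually_elim
    case (elim n)
    then have "((real n / ln (real n)) powr (1 / 2))\<^sup>2 = real n / ln (real n)"
      by (simp add: powr_half_sqrt)
    then show ?case by (simp add: b_def power_divide)
  qed
  ultimately have b: "b \<longlonglongrightarrow> 0"
    by (simp add: filterlim_cong)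
  have ln3: "ln (real n) \<ge> 1" if "n \<ge> 3" for n
  proof -
    have "exp 1 \<le> real n" using exp_le that by linarith
    then show ?thesis using that by (subst ln_ge_iff) auto
  qed
  have kb: "real (k n) / real n \<le> b n" "(real (k n))\<^sup>2 / real n \<le> b n"
    "(real (k n))\<^sup>2 * ln (real (k n)) / real n \<le> b n" "0 \<le> ln (real (k n))" "ln (real (k n)) \<le> real n"
    if n: "n \<ge> 3" for n
  proof -
    have k: "1 \<le> real (k n)" "real (k n) \<le> real n" using k_range n by force+
    have "(real (k n))\<^sup>2 * 1 / real n \<le> b n"
      unfolding b_def using ln3[OF n] by (intro divide_right_mono mult_left_mono) auto
    then show 1: "(real (k n))\<^sup>2 / real n \<le> b n" by simp
    have "real (k n) * 1 \<le> (real (k n))\<^sup>2"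
      unfolding power2_eq_square using k by (intro mult_left_mono) auto
    then have "real (k n) / real n \<le> (real (k n))\<^sup>2 / real n"
      by (intro divide_right_mono) auto
    with 1 show "real (k n) / real n \<le> b n" by linarith
    show "(real (k n))\<^sup>2 * ln (real (k n)) / real n \<le> b n"
      unfolding b_def using k by (intro divide_right_mono mult_left_mono) auto
    show "0 \<le> ln (real (k n))" using k by simp
    show "ln (real (k n)) \<le> real n"
      using k ln_le_minus_one[of "real (k n)"] by linarith
  qed
  have "eventually (\<lambda>n. b n < 1/2) sequentially"
    using order_tendstoD(2)[OF b, of "1/2"] by simp
  then have k2: "eventually (\<lambda>n. 2 * k n \<le> n) sequentially"
    using eventually_ge_at_top[of 3]
  proof eventually_elim
    case (elim n)
    then have "real (k n) / real n < 1 / 2" using kb(1)[of n] by linarith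
    then have "2 * real (k n) < real n" using elim by (simp add: field_simps)
    then show ?case by linarith
  qed
  have lnk: "filterlim (\<lambda>n. ln (real (k n))) at_top sequentially"
    by (intro filterlim_compose[OF ln_at_top] filterlim_compose[OF filterlim_real_sequentially] k_top)

  \<comment> \<open>At \<open>t = n * (ln k / 2 + \<alpha>)\<close> the factor
    \<open>k * exp (- 2 * t / n)\<close> is exactly \<open>exp (- 2 * \<alpha>)\<close>, and the
    comparison error is at most \<open>(2 + 4 * \<alpha>) * b n\<close>.\<close>
  have upper: "limsup (\<lambda>n. ereal (d \<alpha> n)) \<le> ereal (exp (1 - 2 * \<alpha>))" if \<alpha>: "\<alpha> \<ge> 0" for \<alpha>
  proof -
    have "eventually (\<lambda>n. ereal (d \<alpha> n) \<le> ereal (exp (1 - 2 * \<alpha>) + (2 + 4 * \<alpha>) * b n)) sequentially"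
      using k2 eventually_ge_at_top[of 3]
    proof eventually_elim
      case (elim n)
      let ?t = "0.5 * real n * ln (real (k n)) + \<alpha> * real n"
      have k1: "k n \<ge> 1" using k_range elim by force
      have t: "0 \<le> ?t" using \<alpha> kb(4)[of n] elim by simp
      have "d \<alpha> n \<le> real (k n) * exp (1 - 2 * ?t / real n) + 4 * (real (k n))\<^sup>2 * ?t / (real n)\<^sup>2"
        unfolding d_def using elim k1 t max_partial_dist_rtr_exp_upper[of "k n" n ?t ?t] by simp
      also have "real (k n) * exp (1 - 2 * ?t / real n) = exp (1 - 2 * \<alpha>)"
      proof -
        have eq: "1 - 2 * ?t / real n = (1 - 2 * \<alpha>) - ln (real (k n))"
          using elim by (simp add: field_simps)
        show ?thesis unfolding eq using k1 by (simp add: exp_diff)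
      qed
      also have "4 * (real (k n))\<^sup>2 * ?t / (real n)\<^sup>2 =
          2 * ((real (k n))\<^sup>2 * ln (real (k n)) / real n) + 4 * \<alpha> * ((real (k n))\<^sup>2 / real n)"
        using elim by (simp add: field_simps power2_eq_square)
      also have "\<dots> \<le> 2 * b n + 4 * \<alpha> * b n"
        using kb(2,3)[of n] elim \<alpha> by (intro add_mono mult_left_mono) auto
      finally show ?case by (simp add: distrib_right)
    qed
    then have "limsup (\<lambda>n. ereal (d \<alpha> n)) \<le>
        limsup (\<lambda>n. ereal (exp (1 - 2 * \<alpha>) + (2 + 4 * \<alpha>) * b n))"
      by (rule Limsup_mono)
    also have "(\<lambda>n. exp (1 - 2 * \<alpha>) + (2 + 4 * \<alpha>) * b n) \<longlonglongrightarrow> exp (1 - 2 * \<alpha>) + (2 + 4 * \<alpha>) * 0"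
      by (intro tendsto_intros b)
    then have "limsup (\<lambda>n. ereal (exp (1 - 2 * \<alpha>) + (2 + 4 * \<alpha>) * b n)) = ereal (exp (1 - 2 * \<alpha>))"
      by (intro lim_imp_Limsup) auto
    finally show ?thesis .
  qed
  \<comment> \<open>The \<open>4\<close> absorbs the second-order term
    \<open>8 * t / n^2 = 4 * ln k / n + 8 * \<alpha> / n\<close>, which is at most 4 because
    \<open>\<alpha> \<le> 0\<close> and \<open>ln k \<le> n\<close>.\<close>
  have lower: "liminf (\<lambda>n. ereal (d \<alpha> n)) \<ge> ereal (1 - exp (- exp (- 2 * \<alpha> - 4)))" if \<alpha>: "\<alpha> \<le> 0" for \<alpha>
  proof -
    \<comment> \<open>Since \<open>k\<close> tends to infinity, the time is eventually nonnegative
      although \<open>\<alpha> \<le> 0\<close>.\<close>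
    have "eventually (\<lambda>n. - 2 * \<alpha> \<le> ln (real (k n))) sequentially"
      using lnk by (simp add: filterlim_at_top)
    then have "eventually (\<lambda>n. ereal (1 - exp (- exp (- 2 * \<alpha> - 4)) - 2 * b n) \<le> ereal (d \<alpha> n)) sequentially"
      using k2 eventually_ge_at_top[of 4]
    proof eventually_elim
      case (elim n)
      let ?t = "0.5 * real n * ln (real (k n)) + \<alpha> * real n"
      let ?c = "2 / real n + 8 / (real n)\<^sup>2"
      have k1: "k n \<ge> 1" using k_range elim by force
      have n: "real n > 0" using elim by simp
      have "?t = real n * (0.5 * ln (real (k n)) + \<alpha>)"
        by (simp add: algebra_simps)
      then have t: "0 \<le> ?t" using elim by simp
      have "d \<alpha> n \<ge> 1 - exp (- (real (k n) * exp (- ?c * ?t)))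
          - 2 * (real (k n))\<^sup>2 * ?t / (real n)\<^sup>2 - real (k n) / real n"
        unfolding d_def using elim t max_partial_dist_rtr_exp_lower[of n "k n" ?t ?t] by simp
      moreover have "2 * (real (k n))\<^sup>2 * ?t / (real n)\<^sup>2 \<le> b n"
      proof -
        have "2 * (real (k n))\<^sup>2 * ?t / (real n)\<^sup>2 =
            (real (k n))\<^sup>2 * ln (real (k n)) / real n + 2 * \<alpha> * ((real (k n))\<^sup>2 / real n)"
          using n by (simp add: field_simps power2_eq_square)
        moreover have "2 * \<alpha> * ((real (k n))\<^sup>2 / real n) \<le> 0"
          by (rule mult_nonpos_nonneg) (use \<alpha> in auto)
        ultimately show ?thesis using kb(3)[of n] elim by linarith
      qed
      moreover have "real (k n) / real n \<le> b n" using kb(1)[of n] elim by simp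
      moreover have "exp (- 2 * \<alpha> - 4) \<le> real (k n) * exp (- ?c * ?t)"
      proof -
        have "- ?c * ?t = - ln (real (k n)) - 2 * \<alpha> - 4 * (ln (real (k n)) / real n) - 8 * \<alpha> / real n"
          using n by (simp add: field_simps power2_eq_square)
        moreover have "8 * \<alpha> / real n \<le> 0"
          using \<alpha> n by (simp add: divide_nonpos_pos)
        moreover have "ln (real (k n)) / real n \<le> 1"
          using kb(5)[of n] elim by simp
        ultimately have "- 2 * \<alpha> - 4 - ln (real (k n)) \<le> - ?c * ?t"
          by linarith
        then have "real (k n) * exp (- 2 * \<alpha> - 4 - ln (real (k n))) \<le> real (k n) * exp (- ?c * ?t)"
          by (intro mult_left_mono) (simp_all only: exp_le_cancel_iff of_nat_0_le_iff)
        moreover have "real (k n) * exp (- 2 * \<alpha> - 4 - ln (real (k n))) = exp (- 2 * \<alpha> - 4)"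
          using k1 by (simp add: exp_diff)
        ultimately show ?thesis by linarith
      qed
      then have "exp (- (real (k n) * exp (- ?c * ?t))) \<le> exp (- exp (- 2 * \<alpha> - 4))"
        by simp
      ultimately show ?case
        unfolding ereal_less_eq by linarith
    qed
    then have "liminf (\<lambda>n. ereal (1 - exp (- exp (- 2 * \<alpha> - 4)) - 2 * b n)) \<le>
        liminf (\<lambda>n. ereal (d \<alpha> n))"
      by (rule Liminf_mono)
    moreover have "(\<lambda>n. 1 - exp (- exp (- 2 * \<alpha> - 4)) - 2 * b n)
        \<longlonglongrightarrow> 1 - exp (- exp (- 2 * \<alpha> - 4)) - 2 * 0"
      by (intro tendsto_intros b)
    then have "liminf (\<lambda>n. ereal (1 - exp (- exp (- 2 * \<alpha> - 4)) - 2 * b n)) =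
        ereal (1 - exp (- exp (- 2 * \<alpha> - 4)))"
      by (intro lim_imp_Liminf) auto
    ultimately show ?thesis by simp
  qed
  have k_le: "eventually (\<lambda>n. k n \<le> n) sequentially"
    using eventually_ge_at_top[of 1] by eventually_elim (use k_range in force)
  have "((\<lambda>\<alpha>. limsup (\<lambda>n. ereal (d \<alpha> n))) \<longlongrightarrow> 0) at_top"
  proof (rule tendsto_sandwich)
    have "0 \<le> limsup (\<lambda>n. ereal (d \<alpha> n))" for \<alpha>
      by (intro le_Limsup eventually_mono[OF k_le]) (auto simp: d_def max_partial_dist_nonneg)
    then show "eventually (\<lambda>\<alpha>. 0 \<le> limsup (\<lambda>n. ereal (d \<alpha> n))) at_top"
      by simp
    show "eventually (\<lambda>\<alpha>. limsup (\<lambda>n. ereal (d \<alpha> n)) \<le> ereal (exp (1 - 2 * \<alpha>))) at_top"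
      using eventually_ge_at_top[of 0] by eventually_elim (rule upper)
    have "((\<lambda>\<alpha>::real. exp (1 - 2 * \<alpha>)) \<longlongrightarrow> 0) at_top"
      by real_asymp
    then show "((\<lambda>\<alpha>. ereal (exp (1 - 2 * \<alpha>))) \<longlongrightarrow> 0) at_top"
      by (simp add: zero_ereal_def)
  qed simp
  moreover have "((\<lambda>\<alpha>. liminf (\<lambda>n. ereal (d \<alpha> n))) \<longlongrightarrow> 1) at_bot"
  proof (rule tendsto_sandwich)
    have "liminf (\<lambda>n. ereal (d \<alpha> n)) \<le> 1" for \<alpha>
      by (intro Liminf_le eventually_mono[OF k_le]) (auto simp: d_def max_partial_dist_le_1)
    then show "eventually (\<lambda>\<alpha>. liminf (\<lambda>n. ereal (d \<alpha> n)) \<le> 1) at_bot"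
      by simp
    show "eventually (\<lambda>\<alpha>. ereal (1 - exp (- exp (- 2 * \<alpha> - 4))) \<le> liminf (\<lambda>n. ereal (d \<alpha> n))) at_bot"
      using eventually_le_at_bot[of 0] by eventually_elim (rule lower)
    have "((\<lambda>\<alpha>::real. 1 - exp (- exp (- 2 * \<alpha> - 4))) \<longlongrightarrow> 1) at_bot"
      by real_asymp
    then show "((\<lambda>\<alpha>. ereal (1 - exp (- exp (- 2 * \<alpha> - 4)))) \<longlongrightarrow> 1) at_bot"
      by (simp add: one_ereal_def)
  qed simp
  moreover have "(\<lambda>n. if n = 0 then 1 else real n) \<in> o(\<lambda>n. 0.5 * real n * ln (real (k n)))"
  proof (rule smalloI_tendsto)
    have "((\<lambda>n. 2 * inverse (ln (real (k n)))) \<longlongrightarrow> 2 * 0) sequentially"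
      by (intro tendsto_mult tendsto_const tendsto_inverse_0_at_top lnk)
    moreover have "eventually (\<lambda>n. 2 * inverse (ln (real (k n))) =
        (if n = 0 then 1 else real n) / (0.5 * real n * ln (real (k n)))) sequentially"
      using eventually_ge_at_top[of 1] by eventually_elim (simp add: field_simps)
    ultimately show "((\<lambda>n. (if n = 0 then 1 else real n) / (0.5 * real n * ln (real (k n)))) \<longlongrightarrow> 0)
        sequentially"
      unfolding mult_zero_right by (rule Lim_transform_eventually)
    have "eventually (\<lambda>n. ln (real (k n)) > 0) sequentially"
      using lnk by (simp add: filterlim_at_top_dense)
    then show "eventually (\<lambda>n. 0.5 * real n * ln (real (k n)) \<noteq> 0) sequentially"
      using eventually_ge_at_top[of 1] by eventually_elim simp
  qed
  ultimately show ?thesis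
    unfolding partial_cutoff_def d_def by auto
qed

text \<open>On the scale \<open>n\<close> the distance is bounded below on each \<open>[0, C n]\<close> and at most \<open>1/2\<close> from some
  \<open>C n\<close> on, so a cutoff time would have to exceed every multiple of \<open>n\<close> and yet lie below one.\<close>

lemma rtr_no_partial_cutoff:
  fixes k :: "nat \<Rightarrow> nat"
  assumes k_range: "\<forall>n\<ge>1. k n \<in> {1..n}" and K: "\<forall>n\<ge>1. k n < K"
  shows "\<not> partial_cutoff rtr_shuffle k t_mix \<omega>"
proof
  assume cutoff: "partial_cutoff rtr_shuffle k t_mix \<omega>"
  define d where "d = (\<lambda>n. max_partial_dist rtr_shuffle n (k n))"
  \<comment> \<open>With this choice \<open>k * exp (1 - 2 * C) \<le> K * exp (- (4 * K - 1)) \<le>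
    1 / 4\<close>, because \<open>exp (4 * K - 1) \<ge> 4 * K\<close>.\<close>
  define C where "C = 2 * real K"
  have k1: "1 \<le> k n" "k n < K" if "n \<ge> 1" for n
    using k_range K that by force+
  have K1: "K \<ge> 1" using k1[of 1] by simp
  have C: "C > 0" using K1 by (simp add: C_def)
  have sq: "(real (k n))\<^sup>2 \<le> (real K)\<^sup>2" if "n \<ge> 1" for n
    using k1[OF that] by (intro power_mono) auto
  have late: "eventually (\<lambda>n. \<forall>t\<ge>C * real n. d n t \<le> 1 / 2) sequentially"
  proof -
    have "eventually (\<lambda>n. 4 * (real K)\<^sup>2 * C / real n < 1 / 4) sequentially"
      by real_asymp
    then show ?thesis
      using eventually_ge_at_top[of "2 * K"] eventually_ge_at_top[of 1]
    proof eventually_elim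
      case (elim n)
      note k = k1[OF elim(3)]
      show ?case
      proof (intro allI impI)
        fix t assume t: "C * real n \<le> t"
        have "d n t \<le> real (k n) * exp (1 - 2 * (C * real n) / real n)
            + 4 * (real (k n))\<^sup>2 * (C * real n) / (real n)\<^sup>2"
          unfolding d_def using k elim t C by (intro max_partial_dist_rtr_exp_upper) auto
        also have "4 * (real (k n))\<^sup>2 * (C * real n) / (real n)\<^sup>2 = 4 * (real (k n))\<^sup>2 * C / real n"
          using elim by (simp add: power2_eq_square)
        also have "\<dots> \<le> 4 * (real K)\<^sup>2 * C / real n"
          using sq[OF elim(3)] C by (intro divide_right_mono mult_right_mono mult_left_mono) auto
        also have "real (k n) * exp (1 - 2 * (C * real n) / real n) \<le> 1 / 4"
        proof -
          have "real (k n) * exp (1 - 2 * (C * real n) / real n) = real (k n) * exp (- (4 * real K - 1))"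
            using elim by (simp add: C_def)
          also have "\<dots> \<le> real K * exp (- (4 * real K - 1))"
            using k by (intro mult_right_mono) auto
          also have "\<dots> \<le> 1 / 4"
            using exp_ge_add_one_self[of "4 * real K - 1"] unfolding exp_minus by (simp add: field_simps)
          finally show ?thesis .
        qed
        finally show "d n t \<le> 1 / 2" using elim(1) by linarith
      qed
    qed
  qed
  \<comment> \<open>\<open>20 * C\<close> bounds
    \<open>(2 / n + 8 / n^2) * (2 * C * n) = 4 * C + 16 * C / n\<close>; the halving leaves room for
    error terms of order \<open>1 / n\<close>.\<close>
  define \<delta> where "\<delta> = (1 - exp (- exp (- 20 * C))) / 2"
  have \<delta>: "\<delta> > 0" by (simp add: \<delta>_def)
  \<comment> \<open>The range ends at twice the point where \<open>late\<close> begins; the final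
    contradiction uses this factor two.\<close>
  have early: "eventually (\<lambda>n. \<forall>t\<le>2 * C * real n. \<delta> \<le> d n t) sequentially"
  proof -
    have "eventually (\<lambda>n. (4 * (real K)\<^sup>2 * C + real K) / real n < \<delta>) sequentially"
      using \<delta> by real_asymp
    then show ?thesis
      using eventually_ge_at_top[of "2 * K"] eventually_ge_at_top[of 4]
    proof eventually_elim
      case (elim n)
      have n: "n \<ge> 1" using elim by simp
      note k = k1[OF n]
      show ?case
      proof (intro allI impI)
        fix t assume t: "t \<le> 2 * C * real n"
        let ?s = "2 * C * real n" and ?c = "2 / real n + 8 / (real n)\<^sup>2"
        have "d n t \<ge> 1 - exp (- (real (k n) * exp (- ?c * ?s)))
            - 2 * (real (k n))\<^sup>2 * ?s / (real n)\<^sup>2 - real (k n) / real n"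
          unfolding d_def using k elim t C by (intro max_partial_dist_rtr_exp_lower) auto
        moreover have "2 * (real (k n))\<^sup>2 * ?s / (real n)\<^sup>2 + real (k n) / real n
            \<le> (4 * (real K)\<^sup>2 * C + real K) / real n"
        proof -
          have "2 * (real (k n))\<^sup>2 * ?s / (real n)\<^sup>2 + real (k n) / real n =
              (4 * (real (k n))\<^sup>2 * C + real (k n)) / real n"
            using n by (simp add: power2_eq_square add_divide_distrib)
          also have "\<dots> \<le> (4 * (real K)\<^sup>2 * C + real K) / real n"
            using sq[OF n] C k by (intro divide_right_mono add_mono mult_right_mono mult_left_mono) auto
          finally show ?thesis .
        qed
        moreover have "exp (- 20 * C) \<le> real (k n) * exp (- ?c * ?s)"
        proof -
          have "?c * ?s = 4 * C + 16 * C / real n"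
            using n by (simp add: field_simps power2_eq_square)
          also have "16 * C / real n \<le> 16 * C / 1"
            using C n by (intro divide_left_mono) auto
          finally have "- 20 * C \<le> - ?c * ?s"
            unfolding mult_minus_left by linarith
          then have "exp (- 20 * C) \<le> exp (- ?c * ?s)"
            by (simp only: exp_le_cancel_iff)
          also have "\<dots> \<le> real (k n) * exp (- ?c * ?s)"
            using k by simp
          finally show ?thesis .
        qed
        then have "exp (- (real (k n) * exp (- ?c * ?s))) \<le> exp (- exp (- 20 * C))"
          by simp
        moreover have "2 * \<delta> = 1 - exp (- exp (- 20 * C))"
          by (simp add: \<delta>_def)
        ultimately show "\<delta> \<le> d n t"
          using elim(1) by linarith
      qed
    qed
  qed
  have \<omega>: "\<forall>n\<ge>1. \<omega> n > 0" "\<omega> \<in> o(t_mix)"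
    and lims: "((\<lambda>\<alpha>. limsup (\<lambda>n. ereal (d n (t_mix n + \<alpha> * \<omega> n)))) \<longlongrightarrow> 0) at_top"
      "((\<lambda>\<alpha>. liminf (\<lambda>n. ereal (d n (t_mix n + \<alpha> * \<omega> n)))) \<longlongrightarrow> 1) at_bot"
    using cutoff unfolding partial_cutoff_def d_def by auto
  \<comment> \<open>Some \<open>\<alpha>\<close> brings the distance below \<open>\<delta>\<close>,
    so by \<open>early\<close> its time exceeds \<open>2 * C * n\<close>; some
    \<open>\<beta>\<close> keeps it above \<open>1 / 2\<close>, so by \<open>late\<close> its time
    is below \<open>C * n\<close>.\<close>
  have "eventually (\<lambda>\<alpha>. limsup (\<lambda>n. ereal (d n (t_mix n + \<alpha> * \<omega> n))) < ereal \<delta>) at_top"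
    using order_tendstoD(2)[OF lims(1), of "ereal \<delta>"] \<delta> by simp
  then obtain \<alpha> where "limsup (\<lambda>n. ereal (d n (t_mix n + \<alpha> * \<omega> n))) < ereal \<delta>"
    by (auto simp: eventually_at_top_linorder)
  from Limsup_lessD[OF this] have \<alpha>: "eventually (\<lambda>n. d n (t_mix n + \<alpha> * \<omega> n) < \<delta>) sequentially"
    by simp
  have "eventually (\<lambda>\<beta>. ereal (1 / 2) < liminf (\<lambda>n. ereal (d n (t_mix n + \<beta> * \<omega> n)))) at_bot"
    using order_tendstoD(1)[OF lims(2), of "ereal (1 / 2)"] by (simp add: one_ereal_def)
  then obtain \<beta> where "ereal (1 / 2) < liminf (\<lambda>n. ereal (d n (t_mix n + \<beta> * \<omega> n)))"
    by (auto simp: eventually_at_bot_linorder)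
  from less_LiminfD[OF this] have \<beta>: "eventually (\<lambda>n. 1 / 2 < d n (t_mix n + \<beta> * \<omega> n)) sequentially"
    by simp
  define A where "A = \<bar>\<alpha>\<bar> + \<bar>\<beta>\<bar> + 1"
  have A: "A > 0" by (simp add: A_def)
  \<comment> \<open>With shifts of at most a third of \<open>t_mix\<close>, both times lie between
    \<open>2/3\<close> and \<open>4/3\<close> of a positive \<open>t_mix\<close>, so their ratio is
    at most two, against the gap from \<open>C * n\<close> to \<open>2 * C * n\<close>. A negative
    \<open>t_mix\<close> would make the time for \<open>\<alpha>\<close> negative.\<close>
  have "eventually (\<lambda>n. norm (\<omega> n) \<le> 1 / (3 * A) * norm (t_mix n)) sequentially"
    using A by (intro landau_o.smallD[OF \<omega>(2)]) simp
  with late early \<alpha> \<beta> eventually_ge_at_top[of 1]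
  have "eventually (\<lambda>n::nat. False) sequentially"
  proof eventually_elim
    case (elim n)
    have pos: "\<omega> n > 0" using \<omega>(1) elim by simp
    have "A * \<omega> n \<le> \<bar>t_mix n\<bar> / 3"
      using elim(6) pos A by (simp add: field_simps)
    moreover have "\<bar>\<alpha> * \<omega> n\<bar> \<le> A * \<omega> n" "\<bar>\<beta> * \<omega> n\<bar> \<le> A * \<omega> n"
      using pos by (auto simp: abs_mult A_def intro!: mult_right_mono)
    moreover have "t_mix n + \<alpha> * \<omega> n > 2 * C * real n"
      using elim(2,3) by (meson not_le)
    moreover have "t_mix n + \<beta> * \<omega> n < C * real n"
      using elim(1,4) by (meson not_le)
    moreover have "C * real n \<ge> 0" using C by simp
    ultimately show False by linarith
  qed
  then show False by simp
qed

theorem theorem4: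
  fixes k :: "nat \<Rightarrow> nat"
  assumes k_range: "\<forall>n\<ge>1. k n \<in> {1..n}"
  shows "((\<lambda>n. real (k n)) \<in> o(\<lambda>n. (real n / ln (real n)) powr (1 / 2)) \<longrightarrow>
          filterlim k at_top sequentially \<longrightarrow>
          (\<exists>\<omega>. \<omega> \<in> O(\<lambda>n. real n) \<and>
               partial_cutoff rtr_shuffle k (\<lambda>n. 0.5 * real n * ln (real (k n))) \<omega>))
       \<and> ((\<exists>K. \<forall>n\<ge>1. k n < K) \<longrightarrow>
          (\<forall>t_mix \<omega>. \<not> partial_cutoff rtr_shuffle k t_mix \<omega>))"
proof (intro conjI impI allI)
  assume "(\<lambda>n. real (k n)) \<in> o(\<lambda>n. (real n / ln (real n)) powr (1 / 2))"
    and "filterlim k at_top sequentially"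
  then have "partial_cutoff rtr_shuffle k (\<lambda>n. 0.5 * real n * ln (real (k n)))
      (\<lambda>n. if n = 0 then 1 else real n)"
    by (rule rtr_partial_cutoff[OF k_range])
  moreover have "(\<lambda>n. if n = 0 then 1 else real n) \<in> O(\<lambda>n. real n)"
    by (intro bigoI[of _ 1]) (auto intro: eventually_mono[OF eventually_ge_at_top[of 1]])
  ultimately show "\<exists>\<omega>. \<omega> \<in> O(\<lambda>n. real n) \<and>
      partial_cutoff rtr_shuffle k (\<lambda>n. 0.5 * real n * ln (real (k n))) \<omega>"
    by blast
next
  fix t_mix \<omega>
  assume "\<exists>K. \<forall>n\<ge>1. k n < K"
  then show "\<not> partial_cutoff rtr_shuffle k t_mix \<omega>"
    using rtr_no_partial_cutoff[OF k_range] by blast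
qed

end
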